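(* Let $u\in V_h$ and let $V_r\subseteq V_h$ be a Zolotarëv space (associated with $u$) with spectral interval $\sigma=[\lambda_L^2,\lambda_U^2]$, let $\delta=\lambda_L^2/\lambda_U^2$, and suppose $r+1\le m$. Then there exists a constant $C\in\mathbb{R}^+$ and a constant $c\in\mathbb{R}^+$ independent of $r$ and $u$ such that $$\|\mathcal{L}_{H_r^s}(u)-\mathcal{L}_{H^s}u\|_0\le c\,e^{-Cr}\|u\|_2 .$$ The constant $C$ depends only on $\delta$ and satisfies $C(\delta)=\mathcal{O}\left(\frac{1}{\ln(1/\delta)}\right)$ as $\delta\to0$. Its precise value is $C=C^*$. Moreover, if $s\in(0,\tfrac12)$, then $\|u\|_2$ in the estimate $\|\mathcal{L}_{H_r^s}(u)-\mathcal{L}_{H^s}u\|_0\le c\,e^{-Cr}\|u\|_2$ can be replaced by $\|u\|_1$.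
   Context: Setting. $\mathscr{V}_0,\mathscr{V}_1$ are real Hilbert spaces with scalar products $\langle\cdot,\cdot\rangle_0,\langle\cdot,\cdot\rangle_1$ and induced norms $\|\cdot\|_0,\|\cdot\|_1$, such that $\mathscr{V}_1\subseteq\mathscr{V}_0$ is dense with compact embedding; $s\in(0,1)$. $V_h\subseteq\mathscr{V}_1$ is a (finite element) subspace of finite dimension $N$. $(\varphi_k,\lambda_k^2)_{k=1}^N\subseteq V_h\times\mathbb{R}^+$ are the eigenpairs with $\langle\varphi_k,\varphi_l\rangle_0=\delta_{kl}$, $\langle\varphi_k,w\rangle_1=\lambda_k^2\langle\varphi_k,w\rangle_0$ for all $w\in V_h$, and $0<\lambda_1^2\le\dots\le\lambda_N^2$. For $u\in V_h$ put $u_k:=\langle u,\varphi_k\rangle_0$ and let $m\ge 1$ be the number of pairwise distinct eigenvalues in $\{\lambda_k^2:u_k\ne0\}$. Put $\|v\|_2^2:=\sum_{k=1}^N\lambda_k^4\langle v,\varphi_k\rangle_0^2$ for $v\in V_h$. Reduced space. For $t\ge0$, $\mathrm{v}_N(t)\in V_h$ is the unique solution of $\langle\mathrm{v}_N(t),w\rangle_0+t^2\langle\mathrm{v}_N(t),w\rangle_1=\langle u,w\rangle_0$ for all $w\in V_h$. Given $r\in\mathbb{N}$ and parameters $0=t_0<t_1<\dots<t_r$, $V_r:=\mathrm{span}\{\mathrm{v}_N(t_0),\dots,\mathrm{v}_N(t_r)\}$ (depending on $u$; $u=\mathrm{v}_N(0)\in V_r$). Operators. $\mathcal{L}_{H^s}v:=\sum_{k=1}^N\lambda_k^{2s}\langle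 v,\varphi_k\rangle_0\varphi_k$ for $v\in V_h$. Let $(\phi_j,\mu_j^2)$ be the $\langle\cdot,\cdot\rangle_0$-orthonormal eigenpairs on $V_r$: $\langle\phi_j,w_r\rangle_1=\mu_j^2\langle\phi_j,w_r\rangle_0$ for all $w_r\in V_r$. The reduced basis norm on $V_r$ is $\|v_r\|_{H_r^s}^2:=\sum_j\mu_j^{2s}\langle v_r,\phi_j\rangle_0^2$, with induced scalar product $\langle\cdot,\cdot\rangle_{H_r^s}$. The reduced basis operator $\mathcal{L}_{H_r^s}:V_r\to V_r$ is the induced operator: $\langle v_r,\mathcal{L}_{H_r^s}w_r\rangle_0=\langle v_r,w_r\rangle_{H_r^s}$ for all $v_r,w_r\in V_r$. One writes $\mathcal{L}_{H_r^s}(u)$ for its value at $u$ (nonlinear in $u$ because $V_r$ depends on $u$). Zolotarëv space. $\mathcal{K}(k)=\int_0^{\pi/2}(1-k^2\sin^2\theta)^{-1/2}d\theta$ is the complete elliptic integral of the first kind with elliptic modulus $k$, and $\mathrm{dn}(\theta,k)$ the Jacobi elliptic function with modulus $k$. For $\delta\in(0,1)$, $\delta':=\sqrt{1-\delta^2}$, the Zolotarëv points on $[\delta,1]$ are $\mathcal{Z}_j:=\mathrm{dn}\left(\frac{2(r-j)+1}{2r}\mathcal{K}(\delta'),\delta'\right)$, $j=1,\dots,r$. For $0<a<b$, the transformed Zolotarëv points on $[a,b]$ are $\widehat{\mathcal{Z}}_j:=b\mathcal{Z}_j$, where $\mathcal{Z}_j$ are the Zolotarëv points on $[a/b,1]$.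 $V_r$ is called a Zolotarëv space with spectral interval $\sigma=[\lambda_L^2,\lambda_U^2]$ if $0<\lambda_L^2\le\lambda_1^2$, $\lambda_U^2\ge\lambda_N^2$ (with $\lambda_L^2<\lambda_U^2$), and $t_1^2,\dots,t_r^2$ are the transformed Zolotarëv points on $\sigma^{inv}:=[\lambda_U^{-2},\lambda_L^{-2}]$. Constant. $C^*=C^*(\delta):=\frac{\pi\mathcal{K}(\mu_1)}{4\mathcal{K}(\mu)}$ with $\mu:=\left(\frac{1-\sqrt\delta}{1+\sqrt\delta}\right)^2$ and $\mu_1:=\sqrt{1-\mu^2}$. *)

theory Defs
  imports "HOL-Analysis.Analysis" "HOL-Library.Landau_Symbols"
begin

text \<open>
  The inclusion of the Hilbert space \<open>V\<^sub>1\<close> into the Hilbert space \<open>V\<^sub>0\<close> is an injective linear map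
  \<open>J :: 'b \<Rightarrow> 'a\<close>. Hence the scalar product and the norm of \<open>V\<^sub>1\<close> are the library's \<open>\<bullet>\<close> and \<open>norm\<close>
  on \<open>'b\<close>, while those of \<open>V\<^sub>0\<close>, restricted to \<open>V\<^sub>1\<close>, are the following.
\<close>

definition ip0 :: "('b::real_inner \<Rightarrow> 'a::real_inner) \<Rightarrow> 'b \<Rightarrow> 'b \<Rightarrow> real"
  where "ip0 J v w = J v \<bullet> J w"

definition norm0 :: "('b::real_inner \<Rightarrow> 'a::real_inner) \<Rightarrow> 'b \<Rightarrow> real"
  where "norm0 J v = norm (J v)"


text \<open>
  A full \<open>V\<^sub>0\<close>-orthonormal system of eigenpairs \<open>(\<phi> k, (lam k)\<^sup>2)\<close>, \<open>k = 1, \<dots>, dim V\<close>, of a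
  finite-dimensional subspace \<open>V\<close>. The function \<open>lam\<close> holds the positive roots of the eigenvalues.
\<close>

definition eigenpairs_on ::
  "('b::real_inner \<Rightarrow> 'a::real_inner) \<Rightarrow> 'b set \<Rightarrow> (nat \<Rightarrow> 'b) \<Rightarrow> (nat \<Rightarrow> real) \<Rightarrow> bool"
  where "eigenpairs_on J V \<phi> lam \<longleftrightarrow>
    (\<forall>k\<in>{1..dim V}. \<phi> k \<in> V \<and> 0 < lam k) \<and>
    (\<forall>k\<in>{1..dim V}. \<forall>l\<in>{1..dim V}. ip0 J (\<phi> k) (\<phi> l) = (if k = l then 1 else 0)) \<and>
    (\<forall>k\<in>{1..dim V}. \<forall>w\<in>V. \<phi> k \<bullet> w = (lam k)\<^sup>2 * ip0 J (\<phi> k) w)"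

definition num_active_eigenvalues ::
  "('b::real_inner \<Rightarrow> 'a::real_inner) \<Rightarrow> nat \<Rightarrow> (nat \<Rightarrow> 'b) \<Rightarrow> (nat \<Rightarrow> real) \<Rightarrow> 'b \<Rightarrow> nat"
  where "num_active_eigenvalues J N \<phi> lam u =
    card {(lam k)\<^sup>2 | k. k \<in> {1..N} \<and> ip0 J u (\<phi> k) \<noteq> 0}"

definition norm2 ::
  "('b::real_inner \<Rightarrow> 'a::real_inner) \<Rightarrow> nat \<Rightarrow> (nat \<Rightarrow> 'b) \<Rightarrow> (nat \<Rightarrow> real) \<Rightarrow> 'b \<Rightarrow> real"
  where "norm2 J N \<phi> lam v = sqrt (\<Sum>k=1..N. (lam k) ^ 4 * (ip0 J v (\<phi> k))\<^sup>2)"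

definition frac_op ::
  "('b::real_inner \<Rightarrow> 'a::real_inner) \<Rightarrow> nat \<Rightarrow> (nat \<Rightarrow> 'b) \<Rightarrow> (nat \<Rightarrow> real) \<Rightarrow> real \<Rightarrow> 'b \<Rightarrow> 'b"
  where "frac_op J N \<phi> lam s v = (\<Sum>k=1..N. (lam k powr (2 * s) * ip0 J v (\<phi> k)) *\<^sub>R \<phi> k)"


definition snapshot :: "('b::real_inner \<Rightarrow> 'a::real_inner) \<Rightarrow> 'b set \<Rightarrow> 'b \<Rightarrow> real \<Rightarrow> 'b"
  where "snapshot J V u t =
    (THE v. v \<in> V \<and> (\<forall>w\<in>V. ip0 J v w + t\<^sup>2 * (v \<bullet> w) = ip0 J u w))"

definition reduced_space ::
  "('b::real_inner \<Rightarrow> 'a::real_inner) \<Rightarrow> 'b set \<Rightarrow> 'b \<Rightarrow> (nat \<Rightarrow> real) \<Rightarrow> nat \<Rightarrow> 'b set"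
  where "reduced_space J V u t r = span ((\<lambda>i. snapshot J V u (t i)) ` {0..r})"

text \<open>The following are formed with the eigenpairs \<open>(\<psi> j, (\<mu> j)\<^sup>2)\<close> of the reduced space \<open>Vr\<close>.\<close>

definition rb_norm ::
  "('b::real_inner \<Rightarrow> 'a::real_inner) \<Rightarrow> 'b set \<Rightarrow> (nat \<Rightarrow> 'b) \<Rightarrow> (nat \<Rightarrow> real) \<Rightarrow> real \<Rightarrow> 'b \<Rightarrow> real"
  where "rb_norm J Vr \<psi> \<mu> s v = sqrt (\<Sum>j=1..dim Vr. \<mu> j powr (2 * s) * (ip0 J v (\<psi> j))\<^sup>2)"

definition rb_ip ::
  "('b::real_inner \<Rightarrow> 'a::real_inner) \<Rightarrow> 'b set \<Rightarrow> (nat \<Rightarrow> 'b) \<Rightarrow> (nat \<Rightarrow> real) \<Rightarrow> real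
    \<Rightarrow> 'b \<Rightarrow> 'b \<Rightarrow> real"
  where "rb_ip J Vr \<psi> \<mu> s v w =
    (\<Sum>j=1..dim Vr. \<mu> j powr (2 * s) * ip0 J v (\<psi> j) * ip0 J w (\<psi> j))"

lemma rb_norm_power2: "(rb_norm J Vr \<psi> \<mu> s v)\<^sup>2 = rb_ip J Vr \<psi> \<mu> s v v"
  unfolding rb_norm_def rb_ip_def
  by (subst real_sqrt_pow2) (auto intro!: sum_nonneg simp: power2_eq_square mult.assoc)

definition rb_op ::
  "('b::real_inner \<Rightarrow> 'a::real_inner) \<Rightarrow> 'b set \<Rightarrow> (nat \<Rightarrow> 'b) \<Rightarrow> (nat \<Rightarrow> real) \<Rightarrow> real \<Rightarrow> 'b \<Rightarrow> 'b"
  where "rb_op J Vr \<psi> \<mu> s w =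
    (THE z. z \<in> Vr \<and> (\<forall>v\<in>Vr. ip0 J v z = rb_ip J Vr \<psi> \<mu> s v w))"


text \<open>
  Elliptic integrals and functions are parametrised by the modulus \<open>k\<close> (not by \<open>k\<^sup>2\<close>). For
  \<open>\<bar>k\<bar> < 1\<close> the incomplete integral is an increasing bijection of the reals in its first argument,
  and the amplitude is its inverse.
\<close>

definition elliptic_F :: "real \<Rightarrow> real \<Rightarrow> real"
  where "elliptic_F x k = (LBINT \<theta>=ereal 0..ereal x. 1 / sqrt (1 - k\<^sup>2 * (sin \<theta>)\<^sup>2))"

definition elliptic_K :: "real \<Rightarrow> real"
  where "elliptic_K k = elliptic_F (pi / 2) k"

definition jacobi_am :: "real \<Rightarrow> real \<Rightarrow> real"
  where "jacobi_am u k = (THE x. elliptic_F x k = u)"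

definition jacobi_dn :: "real \<Rightarrow> real \<Rightarrow> real"
  where "jacobi_dn u k = sqrt (1 - k\<^sup>2 * (sin (jacobi_am u k))\<^sup>2)"

definition zolotarev_point :: "real \<Rightarrow> nat \<Rightarrow> nat \<Rightarrow> real"
  where "zolotarev_point \<delta> r j =
    (let \<delta>' = sqrt (1 - \<delta>\<^sup>2)
     in jacobi_dn ((2 * (real r - real j) + 1) / (2 * real r) * elliptic_K \<delta>') \<delta>')"

definition transformed_zolotarev_point :: "real \<Rightarrow> real \<Rightarrow> nat \<Rightarrow> nat \<Rightarrow> real"
  where "transformed_zolotarev_point a b r j = b * zolotarev_point (a / b) r j"

text \<open>
  \<open>Vr\<close> is a Zolotarev space associated with \<open>u\<close>, built from \<open>r\<close> Zolotarev points, with spectral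
  interval \<open>{lamL\<^sup>2..lamU\<^sup>2}\<close>; the eigenvalues of \<open>V\<close> are \<open>(lam 1)\<^sup>2 \<le> \<dots> \<le> (lam (dim V))\<^sup>2\<close>.
\<close>

definition zolotarev_space ::
  "('b::real_inner \<Rightarrow> 'a::real_inner) \<Rightarrow> 'b set \<Rightarrow> (nat \<Rightarrow> real) \<Rightarrow> 'b \<Rightarrow> real \<Rightarrow> real \<Rightarrow> nat
    \<Rightarrow> 'b set \<Rightarrow> bool"
  where "zolotarev_space J V lam u lamL lamU r Vr \<longleftrightarrow>
    0 < lamL\<^sup>2 \<and> lamL\<^sup>2 < lamU\<^sup>2 \<and> lamL\<^sup>2 \<le> (lam 1)\<^sup>2 \<and> (lam (dim V))\<^sup>2 \<le> lamU\<^sup>2 \<and>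
    (\<exists>t. t 0 = 0 \<and> (\<forall>i<r. t i < t (Suc i)) \<and>
         (\<forall>j\<in>{1..r}. (t j)\<^sup>2 = transformed_zolotarev_point (1 / lamU\<^sup>2) (1 / lamL\<^sup>2) r j) \<and>
         Vr = reduced_space J V u t r)"

definition C_star :: "real \<Rightarrow> real"
  where "C_star \<delta> =
    (let \<mu> = ((1 - sqrt \<delta>) / (1 + sqrt \<delta>))\<^sup>2; \<mu>\<^sub>1 = sqrt (1 - \<mu>\<^sup>2)
     in pi * elliptic_K \<mu>\<^sub>1 / (4 * elliptic_K \<mu>))"

end

theory Submission
  imports Defs
begin

text \<open>
  All eigenvalues of the discrete operator \<open>A\<close> and of its Galerkin projection \<open>A\<^sub>r\<close> to \<open>V\<^sub>r\<close> lie in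
  \<open>[lamL\<^sup>2, lamU\<^sup>2]\<close>. On such a bounded spectrum \<open>\<parallel>u\<parallel>\<^sub>0\<close> is dominated by \<open>\<parallel>u\<parallel>\<^sub>1\<close> and by \<open>\<parallel>u\<parallel>\<^sub>2\<close>,
  up to powers of \<open>lamL\<close> that may enter the constant. Both estimates therefore follow from
  \<open>\<parallel>A\<^sub>r\<^sup>s u - A\<^sup>s u\<parallel>\<^sub>0 \<le> const * E\<^sub>r * \<parallel>u\<parallel>\<^sub>0\<close>, where \<open>E\<^sub>r\<close> is the maximum over this
  interval of \<open>\<bar>W\<bar>\<close>, \<open>W y = (\<Prod>j. (t\<^sub>j\<^sup>2 y - 1) / (t\<^sub>j\<^sup>2 y + 1))\<close>, and from the sharp bound \<open>E\<^sub>r \<le> 4 exp (- C\<^sup>* r)\<close>.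

  \<^emph>\<open>From \<open>W\<close> to the operator.\<close> The power \<open>y\<^sup>s\<close> is, up to a constant factor, the integral of
  \<open>x\<^sup>s\<^sup>-\<^sup>1 y / (x + y)\<close> over \<open>x > 0\<close>, so it suffices to compare \<open>A\<close> and \<open>A\<^sub>r\<close> on each function
  \<open>y / (x + y)\<close>. The calculi of \<open>A\<close> and \<open>A\<^sub>r\<close> agree on \<open>u\<close> for the constants and for
  \<open>1 / (1 + t\<^sub>j\<^sup>2 y)\<close>, because the corresponding vectors are the snapshots that span \<open>V\<^sub>r\<close>. Interpolating
  \<open>1 / (x + y)\<close> at the points \<open>1 / t\<^sub>j\<^sup>2\<close> by a combination of these fractions leaves the remainder
  \<open>W y * W x / (x + y)\<close> (\<open>partial_fractions\<close>). Since \<open>\<bar>W x\<bar> \<le> 1\<close> for \<open>x > 0\<close>, the remainder is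
  of size \<open>E\<^sub>r\<close> (\<open>resolvent_error\<close>), and integration over \<open>x\<close> gives \<open>powr_error\<close>.

  \<^emph>\<open>The size of \<open>W\<close>.\<close> Put \<open>l = (1 - \<delta>) / (1 + \<delta>)\<close>. By an ascending Landen
  transformation, the images of the Zolotarev points under \<open>x \<mapsto> (1 - x) / (1 + x)\<close> are values of
  \<open>l sn\<^sup>2(\<cdot>, l)\<close> at equidistant arguments, and by the addition theorem \<open>\<bar>W\<bar>\<close> becomes
  a product of \<open>2 r\<close> copies of \<open>\<surd>l \<bar>sn(\<cdot>, l)\<bar>\<close>, shifted by an equidistant grid in one period of
  \<open>\<bar>sn\<bar>\<close>. Such a grid product is largest midway between two zeros (\<open>sn_grid_max\<close>). Call
  that value \<open>e\<^sub>n(l)\<close> for a grid of \<open>n\<close> points. Passing to a grid twice as fine costs only a constant,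
  \<open>e\<^sub>n(l)\<^sup>2 \<le> 4 e\<^sub>2\<^sub>n(l)\<close>, while the descending Landen transformation, which maps \<open>l\<close> to some \<open>l\<^sub>1\<close>, gives
  exactly \<open>e\<^sub>2\<^sub>n(l) = e\<^sub>n(l\<^sub>1)\<close>. Hence \<open>e\<^sub>n(l)\<^sup>2 \<le> 4 e\<^sub>n(l\<^sub>1)\<close>. The same transformation doubles
  \<open>\<pi> K'(l) / (2 K(l))\<close>. With the crude bounds \<open>e\<^sub>n(k) \<le> k\<^sup>n\<^sup>/\<^sup>2\<close> and \<open>ln k \<le> const - \<pi> K'(k) / (2 K(k))\<close>
  at the end of a long chain of Landen steps, the square roots wipe out the constants and yield
  \<open>e\<^sub>n(l) \<le> 4 exp (- n \<pi> K'(l) / (4 K(l)))\<close>. For \<open>n = 2 r\<close> the exponent is \<open>- C\<^sup>* r\<close>.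
\<close>

section \<open>Jacobi elliptic functions of a real argument\<close>

lemma integral_from_0_deriv:
  fixes g :: "real \<Rightarrow> real"
  assumes "continuous_on UNIV g"
  shows "((\<lambda>x. LBINT t=ereal 0..ereal x. g t) has_real_derivative g x) (at x)"
proof -
  define a b where "a = min 0 x - 1" and "b = max 0 x + 1"
  have ab: "a \<le> 0" "0 \<le> b" "a < x" "x < b" by (auto simp: a_def b_def)
  have "((\<lambda>u. LBINT y=ereal 0..ereal u. g y) has_vector_derivative g x) (at x within {a..b})"
    using ab by (intro interval_integral_FTC2 continuous_on_subset[OF assms]) auto
  moreover have "at x within {a..b} = at x"
    using ab by (simp add: at_within_Icc_at)
  ultimately show ?thesis
    by (simp add: has_real_derivative_iff_has_vector_derivative)
qed

definition jacobi_sn :: "real \<Rightarrow> real \<Rightarrow> real"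
  where "jacobi_sn u k = sin (jacobi_am u k)"

definition jacobi_cn :: "real \<Rightarrow> real \<Rightarrow> real"
  where "jacobi_cn u k = cos (jacobi_am u k)"

lemma delta_pos:
  fixes k S :: real
  assumes "0 < k" "k < 1" "\<bar>S\<bar> \<le> 1"
  shows "0 < 1 - k\<^sup>2 * S\<^sup>2"
proof -
  have "k\<^sup>2 < 1" using assms by (simp add: power_less_one_iff)
  moreover have "S\<^sup>2 \<le> 1" using assms by (simp add: abs_square_le_1)
  ultimately have "k\<^sup>2 * S\<^sup>2 < 1"
    by (smt (verit) mult_left_le zero_le_power2)
  thus ?thesis by simp
qed

context
  fixes k :: real
  assumes k: "0 < k" "k < 1"
begin

lemma sqrt_delta: "0 < sqrt (1 - k\<^sup>2 * (sin \<theta>)\<^sup>2)" "sqrt (1 - k\<^sup>2 * (sin \<theta>)\<^sup>2) \<le> 1"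
  using delta_pos[OF k, of "sin \<theta>"] by auto

lemma elliptic_F_0 [simp]: "elliptic_F 0 k = 0"
  by (simp add: elliptic_F_def)

lemma elliptic_F_deriv:
  "((\<lambda>x. elliptic_F x k) has_real_derivative 1 / sqrt (1 - k\<^sup>2 * (sin x)\<^sup>2)) (at x)"
  unfolding elliptic_F_def
  by (intro integral_from_0_deriv[where g = "\<lambda>x. 1 / sqrt (1 - k\<^sup>2 * (sin x)\<^sup>2)"] continuous_intros ballI)
     (use delta_pos[OF k] in \<open>auto simp: less_imp_neq[symmetric]\<close>)

lemma elliptic_F_strict_mono: "strict_mono (\<lambda>x. elliptic_F x k)"
proof (rule strict_monoI)
  fix x y :: real assume "x < y"
  thus "elliptic_F x k < elliptic_F y k"
  proof (rule DERIV_pos_imp_increasing)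
    fix z :: real
    show "\<exists>D. ((\<lambda>x. elliptic_F x k) has_real_derivative D) (at z) \<and> 0 < D"
      using elliptic_F_deriv[of z] sqrt_delta(1)[of z] zero_less_divide_1_iff by blast
  qed
qed

text \<open>The integrand is at least \<open>1\<close>, so \<open>F x - x\<close> is increasing and \<open>F\<close> passes every value.\<close>
lemma elliptic_F_surj: "\<exists>x. elliptic_F x k = u"
proof -
  have mono: "elliptic_F x k - x \<le> elliptic_F y k - y" if "x \<le> y" for x y
    using that sqrt_delta
    by (intro DERIV_nonneg_imp_nondecreasing[of x y "\<lambda>x. elliptic_F x k - x"])
       (auto intro!: exI derivative_eq_intros elliptic_F_deriv)
  have "elliptic_F (-\<bar>u\<bar>) k \<le> u" "u \<le> elliptic_F \<bar>u\<bar> k"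
    using mono[of "-\<bar>u\<bar>" 0] mono[of 0 "\<bar>u\<bar>"] by auto
  moreover have "isCont (\<lambda>x. elliptic_F x k) x" for x
    using elliptic_F_deriv DERIV_isCont by blast
  ultimately have "\<exists>x\<ge>-\<bar>u\<bar>. x \<le> \<bar>u\<bar> \<and> elliptic_F x k = u"
    by (intro IVT) auto
  thus ?thesis by blast
qed

lemma elliptic_F_eq_iff: "elliptic_F x k = elliptic_F y k \<longleftrightarrow> x = y"
  using strict_mono_eq[OF elliptic_F_strict_mono, of x y] by simp

lemma elliptic_F_am [simp]: "elliptic_F (jacobi_am u k) k = u"
proof -
  obtain x where x: "elliptic_F x k = u" using elliptic_F_surj by blast
  have "jacobi_am u k = x" unfolding jacobi_am_def
  proof (rule the_equality)
    show "elliptic_F x k = u" by (fact x)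
    show "y = x" if "elliptic_F y k = u" for y
      using that x elliptic_F_eq_iff[of y x] by simp
  qed
  with x show ?thesis by simp
qed

lemma am_elliptic_F [simp]: "jacobi_am (elliptic_F x k) k = x"
  using elliptic_F_eq_iff[of "jacobi_am (elliptic_F x k) k" x] by simp

lemma am_deriv: "((\<lambda>u. jacobi_am u k) has_real_derivative jacobi_dn u k) (at u)"
proof -
  have cont: "isCont (\<lambda>u. jacobi_am u k) u"
  proof -
    have "isCont (\<lambda>u. jacobi_am u k) (elliptic_F (jacobi_am u k) k)"
      by (rule isCont_inverse_function[where d = 1])
         (auto intro: DERIV_isCont elliptic_F_deriv)
    thus ?thesis by simp
  qed
  have "((\<lambda>u. jacobi_am u k) has_real_derivative
      inverse (1 / sqrt (1 - k\<^sup>2 * (sin (jacobi_am u k))\<^sup>2))) (at u)"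
    by (rule DERIV_inverse_function[where a = "u - 1" and b = "u + 1", OF elliptic_F_deriv])
       (use cont sqrt_delta(1)[of "jacobi_am u k"] in auto)
  thus ?thesis by (simp add: jacobi_dn_def)
qed

lemma sn_deriv: "((\<lambda>u. jacobi_sn u k) has_real_derivative jacobi_cn u k * jacobi_dn u k) (at u)"
  unfolding jacobi_sn_def jacobi_cn_def
  by (auto intro!: derivative_eq_intros am_deriv)

lemma cn_deriv: "((\<lambda>u. jacobi_cn u k) has_real_derivative - jacobi_sn u k * jacobi_dn u k) (at u)"
  unfolding jacobi_sn_def jacobi_cn_def
  by (auto intro!: derivative_eq_intros am_deriv)

lemma dn_pos: "0 < jacobi_dn u k"
  using sqrt_delta by (simp add: jacobi_dn_def)

lemma cn_sq: "(jacobi_cn u k)\<^sup>2 = 1 - (jacobi_sn u k)\<^sup>2"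
  by (simp add: jacobi_cn_def jacobi_sn_def cos_squared_eq)

lemma dn_sq: "(jacobi_dn u k)\<^sup>2 = 1 - k\<^sup>2 * (jacobi_sn u k)\<^sup>2"
  using delta_pos[OF k, of "jacobi_sn u k"] by (simp add: jacobi_dn_def jacobi_sn_def)

lemma dn_deriv:
  "((\<lambda>u. jacobi_dn u k) has_real_derivative - k\<^sup>2 * jacobi_sn u k * jacobi_cn u k) (at u)"
proof -
  have eq: "(\<lambda>u. jacobi_dn u k) = (\<lambda>u. sqrt (1 - k\<^sup>2 * (jacobi_sn u k)\<^sup>2))"
    by (simp add: jacobi_dn_def jacobi_sn_def)
  have "1 - k\<^sup>2 * (jacobi_sn u k)\<^sup>2 > 0" using dn_sq dn_pos by (metis zero_less_power)
  moreover have "sqrt (1 - k\<^sup>2 * (jacobi_sn u k)\<^sup>2) = jacobi_dn u k"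
    by (simp add: jacobi_dn_def jacobi_sn_def)
  ultimately show ?thesis using dn_pos[of u]
    unfolding eq by (auto intro!: derivative_eq_intros sn_deriv simp: field_simps)
qed

lemma abs_sn_le_1: "\<bar>jacobi_sn u k\<bar> \<le> 1"
  by (simp add: jacobi_sn_def)

lemma am_0 [simp]: "jacobi_am 0 k = 0"
  using am_elliptic_F[of 0] by simp

lemma jacobi_0 [simp]: "jacobi_sn 0 k = 0" "jacobi_cn 0 k = 1" "jacobi_dn 0 k = 1"
  by (simp_all add: jacobi_sn_def jacobi_cn_def jacobi_dn_def)

lemma elliptic_K_ge: "pi / 2 \<le> elliptic_K k"
proof -
  have "elliptic_F 0 k - 0 \<le> elliptic_F (pi/2) k - pi/2"
    using sqrt_delta
    by (intro DERIV_nonneg_imp_nondecreasing[of 0 "pi/2" "\<lambda>x. elliptic_F x k - x"])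
       (auto intro!: exI derivative_eq_intros elliptic_F_deriv)
  thus ?thesis by (simp add: elliptic_K_def)
qed

lemma elliptic_K_pos: "0 < elliptic_K k"
  using elliptic_K_ge pi_half_gt_zero by linarith

lemma am_K [simp]: "jacobi_am (elliptic_K k) k = pi / 2"
  by (simp add: elliptic_K_def)

lemma jacobi_K [simp]: "jacobi_sn (elliptic_K k) k = 1" "jacobi_cn (elliptic_K k) k = 0"
  by (simp_all add: jacobi_sn_def jacobi_cn_def)

lemma am_uminus: "jacobi_am (- u) k = - jacobi_am u k"
proof -
  have "\<forall>x. ((\<lambda>x. elliptic_F (- x) k + elliptic_F x k) has_real_derivative 0) (at x)"
    by (auto intro!: derivative_eq_intros DERIV_chain2[OF elliptic_F_deriv])
  from DERIV_isconst_all[OF this, of "jacobi_am u k" 0]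
  have "elliptic_F (- jacobi_am u k) k = - u" by simp
  thus ?thesis by (metis am_elliptic_F)
qed

lemma sn_uminus [simp]: "jacobi_sn (- u) k = - jacobi_sn u k"
  and cn_uminus [simp]: "jacobi_cn (- u) k = jacobi_cn u k"
  and dn_uminus [simp]: "jacobi_dn (- u) k = jacobi_dn u k"
  by (simp_all add: jacobi_sn_def jacobi_cn_def jacobi_dn_def am_uminus)

lemma am_add_2K: "jacobi_am (u + 2 * elliptic_K k) k = jacobi_am u k + pi"
proof -
  have "\<forall>x. ((\<lambda>x. elliptic_F (x + pi) k - elliptic_F x k) has_real_derivative 0) (at x)"
    by (auto intro!: derivative_eq_intros DERIV_chain2[OF elliptic_F_deriv])
  from DERIV_isconst_all[OF this]
  have c: "elliptic_F (x + pi) k - elliptic_F x k = elliptic_F (y + pi) k - elliptic_F y k" for x y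
    by blast
  have "elliptic_F (- (pi/2)) k = - elliptic_K k"
    by (metis am_K am_uminus elliptic_F_am)
  with c[of "jacobi_am u k" "- (pi/2)"]
  have "elliptic_F (jacobi_am u k + pi) k = u + 2 * elliptic_K k"
    by (simp add: elliptic_K_def)
  thus ?thesis by (metis am_elliptic_F)
qed

lemma sn_add_2K: "jacobi_sn (u + 2 * elliptic_K k) k = - jacobi_sn u k"
  by (simp add: jacobi_sn_def am_add_2K)

lemma sn_2K [simp]: "jacobi_sn (2 * elliptic_K k) k = 0"
  using sn_add_2K[of 0] by simp

lemma am_strict_mono: "u < v \<Longrightarrow> jacobi_am u k < jacobi_am v k"
  by (metis elliptic_F_am elliptic_F_strict_mono strict_mono_less)

lemma sn_pos: "0 < u \<Longrightarrow> u < 2 * elliptic_K k \<Longrightarrow> 0 < jacobi_sn u k"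
  unfolding jacobi_sn_def
  using am_strict_mono[of 0 u] am_strict_mono[of u "2 * elliptic_K k"] am_add_2K[of 0]
  by (intro sin_gt_zero) auto

lemma sn_mono:
  assumes "0 \<le> u" "u \<le> v" "v \<le> elliptic_K k"
  shows "jacobi_sn u k \<le> jacobi_sn v k"
proof -
  have m: "jacobi_am x k \<le> jacobi_am y k" if "x \<le> y" for x y
    using am_strict_mono[of x y] that by (cases "x = y") auto
  have "0 \<le> jacobi_am u k" using m[OF assms(1)] by simp
  moreover have "jacobi_am v k \<le> pi / 2" using m[OF assms(3)] by simp
  ultimately show ?thesis
    unfolding jacobi_sn_def using m[OF assms(2)] by (intro sin_monotone_2pi_le) auto
qed

lemma sn_denom_pos: "0 < 1 - k\<^sup>2 * (jacobi_sn u k)\<^sup>2 * (jacobi_sn v k)\<^sup>2"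
proof -
  have "\<bar>jacobi_sn u k * jacobi_sn v k\<bar> \<le> 1"
    using abs_sn_le_1[of u] abs_sn_le_1[of v] by (simp add: abs_mult mult_le_one)
  from delta_pos[OF k this] show ?thesis by (simp add: power_mult_distrib mult.assoc)
qed

text \<open>
  Euler's argument: along \<open>u + v = c\<close> the right-hand side has derivative zero, and at \<open>v = 0\<close> it
  equals \<open>sn c\<close>.
\<close>
lemma sn_add:
  "jacobi_sn (u + v) k =
    (jacobi_sn u k * jacobi_cn v k * jacobi_dn v k + jacobi_sn v k * jacobi_cn u k * jacobi_dn u k)
    / (1 - k\<^sup>2 * (jacobi_sn u k)\<^sup>2 * (jacobi_sn v k)\<^sup>2)"
proof -
  define c where "c = u + v"
  define num where "num x = jacobi_sn x k * jacobi_cn (c - x) k * jacobi_dn (c - x) k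
      + jacobi_sn (c - x) k * jacobi_cn x k * jacobi_dn x k" for x
  define den where "den x = 1 - k\<^sup>2 * (jacobi_sn x k)\<^sup>2 * (jacobi_sn (c - x) k)\<^sup>2" for x
  have den: "den x \<noteq> 0" for x unfolding den_def using sn_denom_pos[of x "c - x"] by simp
  have "((\<lambda>x. num x / den x) has_real_derivative 0) (at x)" for x
  proof -
    define s1 c1 d1 s2 c2 d2 where defs: "s1 = jacobi_sn x k" "c1 = jacobi_cn x k" "d1 = jacobi_dn x k"
      "s2 = jacobi_sn (c - x) k" "c2 = jacobi_cn (c - x) k" "d2 = jacobi_dn (c - x) k"
    have sq: "c1\<^sup>2 = 1 - s1\<^sup>2" "c2\<^sup>2 = 1 - s2\<^sup>2" "d1\<^sup>2 = 1 - k\<^sup>2 * s1\<^sup>2" "d2\<^sup>2 = 1 - k\<^sup>2 * s2\<^sup>2"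
      by (simp_all add: defs cn_sq dn_sq)
    have "(num has_real_derivative s1 * s2 * (d2\<^sup>2 + k\<^sup>2 * c2\<^sup>2 - d1\<^sup>2 - k\<^sup>2 * c1\<^sup>2)) (at x)"
      unfolding num_def
      by (auto intro!: derivative_eq_intros sn_deriv cn_deriv dn_deriv
            DERIV_chain2[OF sn_deriv] DERIV_chain2[OF cn_deriv] DERIV_chain2[OF dn_deriv])
         (simp add: defs[symmetric] power2_eq_square algebra_simps)
    hence dnum: "(num has_real_derivative 2 * k\<^sup>2 * s1 * s2 * (s1\<^sup>2 - s2\<^sup>2)) (at x)"
      by (rule DERIV_cong) (simp add: sq algebra_simps)
    have dden: "(den has_real_derivative - 2 * k\<^sup>2 * s1 * s2 * (s2 * c1 * d1 - s1 * c2 * d2)) (at x)"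
      unfolding den_def
      by (auto intro!: derivative_eq_intros sn_deriv DERIV_chain2[OF sn_deriv])
         (simp add: defs[symmetric] power2_eq_square algebra_simps)
    have prod: "(s1 * c2 * d2)\<^sup>2 - (s2 * c1 * d1)\<^sup>2 = (s1\<^sup>2 - s2\<^sup>2) * (1 - k\<^sup>2 * s1\<^sup>2 * s2\<^sup>2)"
      unfolding power_mult_distrib sq by algebra
    have eq: "2 * k\<^sup>2 * s1 * s2 * (s1\<^sup>2 - s2\<^sup>2) * den x
        = num x * (- 2 * k\<^sup>2 * s1 * s2 * (s2 * c1 * d1 - s1 * c2 * d2))"
      using prod unfolding num_def den_def defs[symmetric] by algebra
    show ?thesis
      by (intro DERIV_cong[OF DERIV_divide[OF dnum dden den]]) (simp only: eq diff_self div_0)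
  qed
  hence "num u / den u = num c / den c"
    using DERIV_isconst_all by blast
  also have "\<dots> = jacobi_sn c k" by (simp add: num_def den_def)
  finally show ?thesis by (simp add: num_def den_def c_def)
qed

text \<open>
  The form of the addition theorem on which everything below rests: with \<open>p = k sn\<^sup>2 u\<close> and
  \<open>q = k sn\<^sup>2 v\<close> the right-hand side times \<open>k\<close> is the pseudo-hyperbolic difference
  \<open>(p - q) / (1 - p q)\<close>.
\<close>
lemma sn_add_mult_sn_diff:
  "jacobi_sn (u + v) k * jacobi_sn (u - v) k =
    ((jacobi_sn u k)\<^sup>2 - (jacobi_sn v k)\<^sup>2) / (1 - k\<^sup>2 * (jacobi_sn u k)\<^sup>2 * (jacobi_sn v k)\<^sup>2)"
proof -
  define s1 c1 d1 s2 c2 d2 where defs: "s1 = jacobi_sn u k" "c1 = jacobi_cn u k" "d1 = jacobi_dn u k"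
    "s2 = jacobi_sn v k" "c2 = jacobi_cn v k" "d2 = jacobi_dn v k"
  define E where "E = 1 - k\<^sup>2 * s1\<^sup>2 * s2\<^sup>2"
  have E: "E \<noteq> 0" using sn_denom_pos[of u v] by (simp add: E_def defs)
  have sq: "c1\<^sup>2 = 1 - s1\<^sup>2" "c2\<^sup>2 = 1 - s2\<^sup>2" "d1\<^sup>2 = 1 - k\<^sup>2 * s1\<^sup>2" "d2\<^sup>2 = 1 - k\<^sup>2 * s2\<^sup>2"
    by (simp_all add: defs cn_sq dn_sq)
  have "(s1 * c2 * d2)\<^sup>2 - (s2 * c1 * d1)\<^sup>2 = (s1\<^sup>2 - s2\<^sup>2) * E"
    unfolding power_mult_distrib sq E_def by algebra
  hence "(s1 * c2 * d2 + s2 * c1 * d1) * (s1 * c2 * d2 - s2 * c1 * d1) = (s1\<^sup>2 - s2\<^sup>2) * E"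
    by (simp add: power2_eq_square algebra_simps)
  moreover have "jacobi_sn (u + v) k = (s1 * c2 * d2 + s2 * c1 * d1) / E"
    by (simp add: sn_add defs E_def)
  moreover have "jacobi_sn (u - v) k = (s1 * c2 * d2 - s2 * c1 * d1) / E"
    using sn_add[of u "- v"] by (simp add: defs E_def)
  ultimately have "jacobi_sn (u + v) k * jacobi_sn (u - v) k = (s1\<^sup>2 - s2\<^sup>2) * E / (E * E)"
    by simp
  thus ?thesis using E by (simp add: defs[symmetric] E_def[symmetric])
qed

lemma sn_add_K: "jacobi_sn (u + elliptic_K k) k = jacobi_cn u k / jacobi_dn u k"
proof -
  have "jacobi_sn (u + elliptic_K k) k = jacobi_cn u k * jacobi_dn u k / (jacobi_dn u k)\<^sup>2"
    by (simp add: sn_add dn_sq)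
  thus ?thesis by (simp add: power2_eq_square)
qed

text \<open>The duplication formula and \<open>(cn u * dn u)\<^sup>2 = (1 - s\<^sup>2) (1 - k\<^sup>2 s\<^sup>2) \<le> (1 - k\<^sup>2 s\<^sup>4)\<^sup>2\<close> for \<open>s = sn u\<close>.\<close>
lemma sn_double_le:
  assumes "0 \<le> u" "u \<le> elliptic_K k"
  shows "jacobi_sn (2 * u) k \<le> 2 * jacobi_sn u k"
proof -
  define s c d where defs: "s = jacobi_sn u k" "c = jacobi_cn u k" "d = jacobi_dn u k"
  have s: "0 \<le> s" using sn_mono[of 0 u] assms by (simp add: defs)
  have E: "0 < 1 - k\<^sup>2 * s\<^sup>2 * s\<^sup>2" unfolding defs by (rule sn_denom_pos)
  have k2: "k\<^sup>2 \<le> 1" "s\<^sup>2 \<le> 1"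
    using k abs_sn_le_1[of u] by (auto simp: defs abs_square_le_1 power_le_one)
  have "k\<^sup>2 * s\<^sup>2 * s\<^sup>2 \<le> k\<^sup>2 * s\<^sup>2" "k\<^sup>2 * s\<^sup>2 * s\<^sup>2 \<le> s\<^sup>2"
    "k\<^sup>2 * s\<^sup>2 \<le> 1"
    using k2 by (auto simp: mult_left_le mult_le_one intro: mult_left_le_one_le)
  hence "c\<^sup>2 * d\<^sup>2 \<le> (1 - k\<^sup>2 * s\<^sup>2 * s\<^sup>2) * (1 - k\<^sup>2 * s\<^sup>2 * s\<^sup>2)"
    using E k2 unfolding defs cn_sq dn_sq by (intro mult_mono) (auto simp: defs)
  hence "(c * d)\<^sup>2 \<le> (1 - k\<^sup>2 * s\<^sup>2 * s\<^sup>2)\<^sup>2"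
    by (simp only: power_mult_distrib power2_eq_square[of "1 - k\<^sup>2 * s\<^sup>2 * s\<^sup>2"])
  hence "c * d \<le> 1 - k\<^sup>2 * s\<^sup>2 * s\<^sup>2"
    by (rule power2_le_imp_le) (use E in simp)
  hence "2 * s * (c * d) \<le> 2 * s * (1 - k\<^sup>2 * s\<^sup>2 * s\<^sup>2)"
    using s by (intro mult_left_mono) auto
  moreover have "jacobi_sn (2 * u) k = 2 * s * (c * d) / (1 - k\<^sup>2 * s\<^sup>2 * s\<^sup>2)"
    using sn_add[of u u] by (simp add: defs algebra_simps)
  ultimately show ?thesis using E by (simp only: defs[symmetric] pos_divide_le_eq)
qed

text \<open>
  A triple that satisfies the algebraic and differential relations of \<open>sn\<close>, \<open>cn\<close>, \<open>dn\<close> consists of these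
  functions: \<open>(C, S)\<close> moves on the unit circle with angle \<open>\<psi> = \<integral> a D\<close>, and \<open>F \<circ> \<psi>\<close> has derivative
  \<open>a\<close>, so \<open>\<psi> u\<close> is the amplitude of \<open>a u\<close>. This reduces a Landen transformation to the verification of
  rational identities.
\<close>
lemma jacobi_unique:
  fixes S C D :: "real \<Rightarrow> real"
  assumes S: "\<And>u. (S has_real_derivative a * C u * D u) (at u)"
    and C: "\<And>u. (C has_real_derivative - (a * S u * D u)) (at u)"
    and D: "\<And>u. 0 < D u" "\<And>u. (D u)\<^sup>2 = 1 - k\<^sup>2 * (S u)\<^sup>2" "continuous_on UNIV D"
    and 0: "S 0 = 0" "C 0 = 1"
  shows "jacobi_sn (a * u) k = S u" "jacobi_cn (a * u) k = C u" "jacobi_dn (a * u) k = D u"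
proof -
  define \<psi> where "\<psi> x = (LBINT t=ereal 0..ereal x. a * D t)" for x
  have \<psi>: "(\<psi> has_real_derivative a * D x) (at x)" for x
    unfolding \<psi>_def by (intro integral_from_0_deriv continuous_intros D)
  have \<psi>0: "\<psi> 0 = 0" by (simp add: \<psi>_def)
  have "\<forall>x. ((\<lambda>x. S x * cos (\<psi> x) - C x * sin (\<psi> x)) has_real_derivative 0) (at x)"
    by (auto intro!: derivative_eq_intros S C \<psi> simp: algebra_simps)
  from DERIV_isconst_all[OF this, of _ 0] have X: "S x * cos (\<psi> x) = C x * sin (\<psi> x)" for x
    by (simp add: \<psi>0 0)
  have "\<forall>x. ((\<lambda>x. C x * cos (\<psi> x) + S x * sin (\<psi> x)) has_real_derivative 0) (at x)"
    by (auto intro!: derivative_eq_intros S C \<psi> simp: algebra_simps)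
  from DERIV_isconst_all[OF this, of _ 0] have Y: "C x * cos (\<psi> x) + S x * sin (\<psi> x) = 1" for x
    by (simp add: \<psi>0 0)
  have SC: "S x = sin (\<psi> x)" "C x = cos (\<psi> x)" for x
    using X[of x] Y[of x] sin_cos_squared_add[of "\<psi> x"] by algebra+
  have Dx: "D x = sqrt (1 - k\<^sup>2 * (sin (\<psi> x))\<^sup>2)" for x
    using D(1)[of x] D(2)[of x] by (simp add: SC real_sqrt_unique)
  have "\<forall>x. ((\<lambda>x. elliptic_F (\<psi> x) k - a * x) has_real_derivative 0) (at x)"
    using sqrt_delta(1)[THEN less_imp_neq]
    by (auto intro!: derivative_eq_intros DERIV_chain2[OF elliptic_F_deriv] \<psi> simp: Dx)
  from DERIV_isconst_all[OF this, of u 0] have "elliptic_F (\<psi> u) k = a * u" by (simp add: \<psi>0)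
  hence "jacobi_am (a * u) k = \<psi> u" by (metis am_elliptic_F)
  thus "jacobi_sn (a * u) k = S u" "jacobi_cn (a * u) k = C u" "jacobi_dn (a * u) k = D u"
    by (simp_all add: jacobi_sn_def jacobi_cn_def jacobi_dn_def SC Dx)
qed

text \<open>
  The first positive zero of \<open>sn\<close> is \<open>2 K\<close>; this reads off how \<open>K\<close> changes under a transformation of
  \<open>sn\<close>.
\<close>
lemma quarter_period_unique:
  assumes "0 < a" "0 < T" "\<And>u. 0 < u \<Longrightarrow> u < T \<Longrightarrow> 0 < jacobi_sn (a * u) k" "jacobi_sn (a * T) k = 0"
  shows "a * T = 2 * elliptic_K k"
proof (rule antisym)
  show "2 * elliptic_K k \<le> a * T"
    using sn_pos[of "a * T"] assms by fastforce
  show "a * T \<le> 2 * elliptic_K k"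
  proof (rule ccontr)
    assume "\<not> a * T \<le> 2 * elliptic_K k"
    hence "0 < jacobi_sn (a * (2 * elliptic_K k / a)) k"
      using assms(1) elliptic_K_pos by (intro assms(3)) (auto simp: field_simps)
    thus False using assms(1) by simp
  qed
qed

end

section \<open>Landen transformations\<close>
definition landen :: "real \<Rightarrow> real"
  where "landen k = (1 - sqrt (1 - k\<^sup>2)) / (1 + sqrt (1 - k\<^sup>2))"

lemma complementary_modulus:
  fixes k :: real
  assumes "0 < k" "k < 1"
  shows "0 < sqrt (1 - k\<^sup>2)" "sqrt (1 - k\<^sup>2) < 1" "(sqrt (1 - k\<^sup>2))\<^sup>2 = 1 - k\<^sup>2"
proof -
  have "k\<^sup>2 < 1" using assms by (simp add: power_less_one_iff)
  thus "0 < sqrt (1 - k\<^sup>2)" "sqrt (1 - k\<^sup>2) < 1" "(sqrt (1 - k\<^sup>2))\<^sup>2 = 1 - k\<^sup>2"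
    using assms by auto
qed

lemma landen_bounds:
  assumes "0 < k" "k < 1"
  shows "0 < landen k" "landen k < 1"
proof -
  define k' where "k' = sqrt (1 - k\<^sup>2)"
  have "0 < k'" "k' < 1" using complementary_modulus[OF assms] by (simp_all add: k'_def)
  hence "0 < (1 - k') / (1 + k')" "(1 - k') / (1 + k') < 1" by simp_all
  thus "0 < landen k" "landen k < 1" by (simp_all add: landen_def k'_def)
qed

text \<open>The transformation that halves the real period of \<open>sn\<close>.\<close>
lemma descending_landen:
  assumes k: "0 < k" "k < 1"
  defines "k' \<equiv> sqrt (1 - k\<^sup>2)"
  shows "jacobi_sn ((1 + k') * u) (landen k) = (1 + k') * jacobi_sn u k * jacobi_cn u k / jacobi_dn u k"
    and "jacobi_cn ((1 + k') * u) (landen k) = (1 - (1 + k') * (jacobi_sn u k)\<^sup>2) / jacobi_dn u k"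
proof -
  note k' = complementary_modulus[OF k, folded k'_def]
  define l where "l = landen k"
  have l: "0 < l" "l < 1" using landen_bounds[OF k] by (auto simp: l_def)
  have lk: "l * (1 + k') = 1 - k'" using k' by (simp add: l_def landen_def k'_def[symmetric] field_simps)
  define S where "S x = (1 + k') * jacobi_sn x k * jacobi_cn x k / jacobi_dn x k" for x
  define C where "C x = (1 - (1 + k') * (jacobi_sn x k)\<^sup>2) / jacobi_dn x k" for x
  define D where "D x = ((jacobi_dn x k)\<^sup>2 + k') / ((1 + k') * jacobi_dn x k)" for x
  have kk: "k\<^sup>2 = 1 - k'\<^sup>2" using k' by simp
  have dS: "(S has_real_derivative (1 + k') * C x * D x) (at x)" for x
  proof -
    define s c d where defs: "s = jacobi_sn x k" "c = jacobi_cn x k" "d = jacobi_dn x k"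
    have sq: "c\<^sup>2 = 1 - s\<^sup>2" "d\<^sup>2 = 1 - k\<^sup>2 * s\<^sup>2" by (simp_all add: defs cn_sq k dn_sq)
    have d: "d \<noteq> 0" using dn_pos[OF k, of x] by (simp add: defs)
    have "((\<lambda>x. (1 + k') * jacobi_sn x k * jacobi_cn x k) has_real_derivative
        (1 + k') * (c * d * c - s * s * d)) (at x)"
      by (auto intro!: derivative_eq_intros sn_deriv cn_deriv k simp: defs[symmetric] algebra_simps)
    from DERIV_divide[OF this dn_deriv[OF k]] have "(S has_real_derivative
        (((1 + k') * (c * d * c - s * s * d)) * d + (1 + k') * s * c * (k\<^sup>2 * s * c)) / (d * d)) (at x)"
      using d by (simp add: S_def[abs_def] defs[symmetric])
    moreover have "(((1 + k') * (c * d * c - s * s * d)) * d + (1 + k') * s * c * (k\<^sup>2 * s * c))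
        = (1 - (1 + k') * s\<^sup>2) * (d\<^sup>2 + k')"
      using sq kk by algebra
    moreover have "(1 + k') * C x * D x = (1 - (1 + k') * s\<^sup>2) * (d\<^sup>2 + k') / (d * d)"
      using d k' by (simp add: C_def D_def defs[symmetric])
    ultimately show ?thesis by simp
  qed
  have dC: "(C has_real_derivative - ((1 + k') * S x * D x)) (at x)" for x
  proof -
    define s c d where defs: "s = jacobi_sn x k" "c = jacobi_cn x k" "d = jacobi_dn x k"
    have sq: "c\<^sup>2 = 1 - s\<^sup>2" "d\<^sup>2 = 1 - k\<^sup>2 * s\<^sup>2" by (simp_all add: defs cn_sq k dn_sq)
    have d: "d \<noteq> 0" using dn_pos[OF k, of x] by (simp add: defs)
    have "((\<lambda>x. 1 - (1 + k') * (jacobi_sn x k)\<^sup>2) has_real_derivative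
        (- 2 * (1 + k') * s * c * d)) (at x)"
      by (auto intro!: derivative_eq_intros sn_deriv k simp: defs[symmetric] algebra_simps)
    from DERIV_divide[OF this dn_deriv[OF k]] have "(C has_real_derivative
        ((- 2 * (1 + k') * s * c * d) * d + (1 - (1 + k') * s\<^sup>2) * (k\<^sup>2 * s * c)) / (d * d)) (at x)"
      using d by (simp add: C_def[abs_def] defs[symmetric])
    moreover have "((- 2 * (1 + k') * s * c * d) * d + (1 - (1 + k') * s\<^sup>2) * (k\<^sup>2 * s * c))
        = - ((1 + k') * s * c * (d\<^sup>2 + k'))"
      using sq kk by algebra
    moreover have "(1 + k') * S x * D x = (1 + k') * s * c * (d\<^sup>2 + k') / (d * d)"
      using d k' by (simp add: S_def D_def defs[symmetric])
    ultimately show ?thesis by simp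
  qed
  have D1: "0 < D x" for x using k' dn_pos[OF k, of x] by (auto simp: D_def intro!: divide_pos_pos add_pos_pos)
  have D2: "(D x)\<^sup>2 = 1 - l\<^sup>2 * (S x)\<^sup>2" for x
  proof -
    define s c d where defs: "s = jacobi_sn x k" "c = jacobi_cn x k" "d = jacobi_dn x k"
    have sq: "c\<^sup>2 = 1 - s\<^sup>2" "d\<^sup>2 = 1 - k\<^sup>2 * s\<^sup>2" by (simp_all add: defs cn_sq k dn_sq)
    have d: "d \<noteq> 0" using dn_pos[OF k, of x] by (simp add: defs)
    have e: "(1 + k') * d * D x = d\<^sup>2 + k'"
      using d k' by (simp add: D_def defs[symmetric])
    have "d * S x = (1 + k') * s * c" using d by (simp add: S_def defs[symmetric])
    hence f: "d * (l * S x) = (1 - k') * s * c" using lk by algebra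
    have "((1 + k') * d)\<^sup>2 * (D x)\<^sup>2 = (d\<^sup>2 + k')\<^sup>2"
      by (simp add: e[symmetric] power_mult_distrib)
    also have "\<dots> = (1 + k')\<^sup>2 * (d\<^sup>2 - ((1 - k') * s * c)\<^sup>2)"
      unfolding power_mult_distrib sq kk by algebra
    also have "\<dots> = ((1 + k') * d)\<^sup>2 * (1 - (l * S x)\<^sup>2)"
      unfolding f[symmetric] by algebra
    finally have "((1 + k') * d)\<^sup>2 * (D x)\<^sup>2 = ((1 + k') * d)\<^sup>2 * (1 - (l * S x)\<^sup>2)" .
    moreover have "((1 + k') * d)\<^sup>2 \<noteq> 0" using d k' by auto
    ultimately show ?thesis by (simp add: power_mult_distrib)
  qed
  have D3: "continuous_on UNIV D"
    unfolding D_def using dn_deriv[OF k] dn_pos[OF k] k'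
    by (intro continuous_intros continuous_at_imp_continuous_on ballI)
       (auto intro: DERIV_isCont simp: less_imp_neq[symmetric])
  have 0: "S 0 = 0" "C 0 = 1" using k by (simp_all add: S_def C_def)
  show "jacobi_sn ((1 + k') * u) (landen k) = (1 + k') * jacobi_sn u k * jacobi_cn u k / jacobi_dn u k"
    and "jacobi_cn ((1 + k') * u) (landen k) = (1 - (1 + k') * (jacobi_sn u k)\<^sup>2) / jacobi_dn u k"
    using jacobi_unique[OF l dS dC D1 D2 D3 0] by (simp_all add: S_def C_def l_def)
qed

lemma cn_pos:
  assumes "0 < k" "k < 1" "0 < u" "u < elliptic_K k"
  shows "0 < jacobi_cn u k"
  unfolding jacobi_cn_def
  using am_strict_mono[OF assms(1,2), of 0 u] am_strict_mono[OF assms(1,2), of u "elliptic_K k"] assms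
  by (intro cos_gt_zero) auto

lemma elliptic_K_landen:
  assumes k: "0 < k" "k < 1"
  shows "(1 + sqrt (1 - k\<^sup>2)) * elliptic_K k = 2 * elliptic_K (landen k)"
proof -
  define k' where "k' = sqrt (1 - k\<^sup>2)"
  note k' = complementary_modulus[OF k, folded k'_def]
  note desc = descending_landen[OF k, folded k'_def]
  show ?thesis unfolding k'_def[symmetric]
  proof (rule quarter_period_unique[OF landen_bounds[OF k]])
    fix u assume "0 < u" "u < elliptic_K k"
    thus "0 < jacobi_sn ((1 + k') * u) (landen k)"
      unfolding desc
      using k k' sn_pos[OF k, of u] cn_pos[OF k, of u] dn_pos[OF k, of u]
      by (intro divide_pos_pos mult_pos_pos) auto
  qed (use k k' elliptic_K_pos[OF k] in \<open>auto simp: desc\<close>)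
qed

text \<open>The transformation in the opposite direction, from modulus \<open>l\<close> to \<open>\<kappa> = 2 \<surd>l / (1 + l)\<close>.\<close>
lemma ascending_landen:
  assumes l: "0 < l" "l < 1" and \<kappa>: "0 < \<kappa>" "\<kappa> < 1" "\<kappa>\<^sup>2 * (1 + l)\<^sup>2 = 4 * l"
  shows "jacobi_sn ((1 + l) * u) \<kappa> = (1 + l) * jacobi_sn u l / (1 + l * (jacobi_sn u l)\<^sup>2)"
    and "jacobi_dn ((1 + l) * u) \<kappa> = (1 - l * (jacobi_sn u l)\<^sup>2) / (1 + l * (jacobi_sn u l)\<^sup>2)"
proof -
  define S where "S x = (1 + l) * jacobi_sn x l / (1 + l * (jacobi_sn x l)\<^sup>2)" for x
  define C where "C x = jacobi_cn x l * jacobi_dn x l / (1 + l * (jacobi_sn x l)\<^sup>2)" for x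
  define D where "D x = (1 - l * (jacobi_sn x l)\<^sup>2) / (1 + l * (jacobi_sn x l)\<^sup>2)" for x
  have E: "0 < 1 + l * (jacobi_sn x l)\<^sup>2" for x using l by (intro add_pos_nonneg) auto
  have dS: "(S has_real_derivative (1 + l) * C x * D x) (at x)" for x
  proof -
    define s c d where defs: "s = jacobi_sn x l" "c = jacobi_cn x l" "d = jacobi_dn x l"
    define e where "e = 1 + l * s\<^sup>2"
    have e: "e \<noteq> 0" using E[of x] by (simp add: e_def defs)
    have dE: "((\<lambda>x. 1 + l * (jacobi_sn x l)\<^sup>2) has_real_derivative 2 * l * s * c * d) (at x)"
      by (auto intro!: derivative_eq_intros sn_deriv l simp: defs[symmetric])
    have "((\<lambda>x. (1 + l) * jacobi_sn x l) has_real_derivative (1 + l) * (c * d)) (at x)"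
      by (auto intro!: derivative_eq_intros sn_deriv l simp: defs[symmetric])
    from DERIV_divide[OF this dE] have
      "(S has_real_derivative ((1 + l) * (c * d) * e - (1 + l) * s * (2 * l * s * c * d)) / (e * e)) (at x)"
      using e by (simp add: S_def[abs_def] defs[symmetric] e_def[symmetric])
    moreover have "(1 + l) * (c * d) * e - (1 + l) * s * (2 * l * s * c * d) = (1 + l) * (c * d) * (1 - l * s\<^sup>2)"
      unfolding e_def by algebra
    moreover have "(1 + l) * C x * D x = (1 + l) * (c * d) * (1 - l * s\<^sup>2) / (e * e)"
      by (simp add: C_def D_def defs[symmetric] e_def[symmetric])
    ultimately show ?thesis by simp
  qed
  have dC: "(C has_real_derivative - ((1 + l) * S x * D x)) (at x)" for x
  proof -
    define s c d where defs: "s = jacobi_sn x l" "c = jacobi_cn x l" "d = jacobi_dn x l"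
    have sq: "c\<^sup>2 = 1 - s\<^sup>2" "d\<^sup>2 = 1 - l\<^sup>2 * s\<^sup>2" by (simp_all add: defs cn_sq l dn_sq)
    define e where "e = 1 + l * s\<^sup>2"
    have e: "e \<noteq> 0" using E[of x] by (simp add: e_def defs)
    have dE: "((\<lambda>x. 1 + l * (jacobi_sn x l)\<^sup>2) has_real_derivative 2 * l * s * c * d) (at x)"
      by (auto intro!: derivative_eq_intros sn_deriv l simp: defs[symmetric])
    have "((\<lambda>x. jacobi_cn x l * jacobi_dn x l) has_real_derivative
        - s * d * d - l\<^sup>2 * s * c * c) (at x)"
      by (auto intro!: derivative_eq_intros cn_deriv dn_deriv l simp: defs[symmetric])
    from DERIV_divide[OF this dE] have "(C has_real_derivative
        ((- s * d * d - l\<^sup>2 * s * c * c) * e - c * d * (2 * l * s * c * d)) / (e * e)) (at x)"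
      using e by (simp add: C_def[abs_def] defs[symmetric] e_def[symmetric])
    moreover have "(- s * d * d - l\<^sup>2 * s * c * c) * e - c * d * (2 * l * s * c * d)
        = - ((1 + l)\<^sup>2 * s * (1 - l * s\<^sup>2))"
      using sq unfolding e_def by algebra
    moreover have "(1 + l) * S x * D x = (1 + l)\<^sup>2 * s * (1 - l * s\<^sup>2) / (e * e)"
      by (simp add: S_def D_def defs[symmetric] e_def[symmetric] power2_eq_square[of "1 + l"])
    ultimately show ?thesis by simp
  qed
  have D1: "0 < D x" for x
  proof -
    have "(jacobi_sn x l)\<^sup>2 \<le> 1" using abs_sn_le_1[OF l] by (simp add: abs_square_le_1)
    hence "l * (jacobi_sn x l)\<^sup>2 \<le> l" using l by (simp add: mult_left_le)
    hence "l * (jacobi_sn x l)\<^sup>2 < 1" using l by linarith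
    thus ?thesis using E by (simp add: D_def)
  qed
  have D2: "(D x)\<^sup>2 = 1 - \<kappa>\<^sup>2 * (S x)\<^sup>2" for x
  proof -
    define s where "s = jacobi_sn x l"
    define e where "e = 1 + l * s\<^sup>2"
    have e: "e \<noteq> 0" using E[of x] by (simp add: e_def s_def)
    have "\<kappa>\<^sup>2 * (S x)\<^sup>2 = 4 * l * s\<^sup>2 / e\<^sup>2"
      using \<kappa>(3) by (simp add: S_def s_def[symmetric] e_def[symmetric] power_divide power_mult_distrib mult.assoc[symmetric])
    moreover have "(D x)\<^sup>2 = (1 - l * s\<^sup>2)\<^sup>2 / e\<^sup>2"
      by (simp add: D_def s_def[symmetric] e_def[symmetric] power_divide)
    moreover have "(1 - l * s\<^sup>2)\<^sup>2 = e\<^sup>2 - 4 * l * s\<^sup>2" unfolding e_def by algebra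
    ultimately show ?thesis using e by (simp add: diff_divide_distrib)
  qed
  have D3: "continuous_on UNIV D"
    unfolding D_def using sn_deriv[OF l] E
    by (intro continuous_intros continuous_at_imp_continuous_on ballI)
       (auto intro: DERIV_isCont simp: less_imp_neq[symmetric])
  have 0: "S 0 = 0" "C 0 = 1" using l by (simp_all add: S_def C_def)
  show "jacobi_sn ((1 + l) * u) \<kappa> = (1 + l) * jacobi_sn u l / (1 + l * (jacobi_sn u l)\<^sup>2)"
    and "jacobi_dn ((1 + l) * u) \<kappa> = (1 - l * (jacobi_sn u l)\<^sup>2) / (1 + l * (jacobi_sn u l)\<^sup>2)"
    using jacobi_unique[OF \<kappa>(1,2) dS dC D1 D2 D3 0] by (simp_all add: S_def D_def)
qed

lemma elliptic_K_ascending_landen: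
  assumes l: "0 < l" "l < 1" and \<kappa>: "0 < \<kappa>" "\<kappa> < 1" "\<kappa>\<^sup>2 * (1 + l)\<^sup>2 = 4 * l"
  shows "elliptic_K \<kappa> = (1 + l) * elliptic_K l"
proof -
  have "(1 + l) * (2 * elliptic_K l) = 2 * elliptic_K \<kappa>"
  proof (rule quarter_period_unique[OF \<kappa>(1,2)])
    fix u assume "0 < u" "u < 2 * elliptic_K l"
    thus "0 < jacobi_sn ((1 + l) * u) \<kappa>"
      unfolding ascending_landen(1)[OF l \<kappa>] using l sn_pos[OF l, of u]
      by (intro divide_pos_pos add_pos_nonneg) auto
  qed (use l elliptic_K_pos[OF l] in \<open>auto simp: ascending_landen(1)[OF l \<kappa>]\<close>)
  thus ?thesis by simp
qed

text \<open>
  The complement of the descended modulus is the ascended complement, so the ascending transformation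
  governs \<open>K'\<close>.
\<close>
lemma complementary_modulus_landen:
  assumes k: "0 < k" "k < 1"
  shows "(sqrt (1 - (landen k)\<^sup>2))\<^sup>2 * (1 + sqrt (1 - k\<^sup>2))\<^sup>2 = 4 * sqrt (1 - k\<^sup>2)"
proof -
  note k' = complementary_modulus[OF k]
  define k' where "k' = sqrt (1 - k\<^sup>2)"
  have lk: "landen k * (1 + k') = 1 - k'" using k' by (simp add: landen_def k'_def[symmetric] field_simps)
  have "(1 - (landen k)\<^sup>2) * (1 + k')\<^sup>2 = 4 * k'" using lk by algebra
  thus ?thesis using complementary_modulus(3)[OF landen_bounds[OF k]] by (simp add: k'_def)
qed

lemma elliptic_K_complementary_landen:
  assumes k: "0 < k" "k < 1"
  shows "elliptic_K (sqrt (1 - (landen k)\<^sup>2)) = (1 + sqrt (1 - k\<^sup>2)) * elliptic_K (sqrt (1 - k\<^sup>2))"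
  by (intro elliptic_K_ascending_landen complementary_modulus landen_bounds complementary_modulus_landen k)

text \<open>With the classical nome \<open>q = exp (- \<pi> K' / K)\<close> this is \<open>- ln q / 2\<close>.\<close>
definition log_nome :: "real \<Rightarrow> real"
  where "log_nome k = pi / 2 * elliptic_K (sqrt (1 - k\<^sup>2)) / elliptic_K k"

lemma log_nome_landen:
  assumes k: "0 < k" "k < 1"
  shows "log_nome (landen k) = 2 * log_nome k"
proof -
  define k' where "k' = sqrt (1 - k\<^sup>2)"
  have k': "1 + k' \<noteq> 0" using complementary_modulus(1)[OF k, folded k'_def] by simp
  have 1: "elliptic_K (landen k) = (1 + k') * elliptic_K k / 2"
    using elliptic_K_landen[OF k] by (simp add: k'_def)
  have 2: "elliptic_K (sqrt (1 - (landen k)\<^sup>2)) = (1 + k') * elliptic_K k'"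
    using elliptic_K_complementary_landen[OF k] by (simp add: k'_def)
  show ?thesis using k' by (simp add: log_nome_def 1 2 k'_def[symmetric])
qed

text \<open>The cosine amplitude of the transformed argument vanishes at half of the old quarter period.\<close>
lemma sn_half_K:
  assumes k: "0 < k" "k < 1"
  shows "(jacobi_sn (elliptic_K k / 2) k)\<^sup>2 = 1 / (1 + sqrt (1 - k\<^sup>2))"
proof -
  define k' where "k' = sqrt (1 - k\<^sup>2)"
  have "(1 + k') * (elliptic_K k / 2) = elliptic_K (landen k)"
    using elliptic_K_landen[OF k] by (simp add: k'_def)
  hence "(1 - (1 + k') * (jacobi_sn (elliptic_K k / 2) k)\<^sup>2) / jacobi_dn (elliptic_K k / 2) k = 0"
    using descending_landen(2)[OF k, of "elliptic_K k / 2"] jacobi_K(2)[OF landen_bounds[OF k]]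
    by (simp add: k'_def)
  moreover have "1 + k' \<noteq> 0" using complementary_modulus(1)[OF k, folded k'_def] by simp
  ultimately show ?thesis using dn_pos[OF k, of "elliptic_K k / 2"] by (simp add: k'_def field_simps)
qed

lemma tan_am_half_K:
  assumes k: "0 < k" "k < 1"
  defines "x \<equiv> jacobi_am (elliptic_K k / 2) k"
  shows "0 < x" "x < pi / 2" "tan x = 1 / sqrt (sqrt (1 - k\<^sup>2))"
proof -
  define k' where "k' = sqrt (1 - k\<^sup>2)"
  have k': "0 < k'" using complementary_modulus[OF k] by (simp add: k'_def)
  show x: "0 < x" "x < pi / 2"
    using am_strict_mono[OF k, of 0 "elliptic_K k / 2"] am_strict_mono[OF k, of "elliptic_K k / 2" "elliptic_K k"]
      elliptic_K_pos[OF k] k by (auto simp: x_def)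
  have s: "(sin x)\<^sup>2 = 1 / (1 + k')"
    using sn_half_K[OF k] by (simp add: x_def jacobi_sn_def k'_def)
  hence "(cos x)\<^sup>2 = k' / (1 + k')"
    using k' by (simp add: cos_squared_eq field_simps)
  with s have "(tan x)\<^sup>2 = 1 / k'"
    using k' by (simp add: tan_def power_divide)
  moreover have "0 < tan x" using x by (intro tan_gt_zero) auto
  ultimately have "tan x = sqrt (1 / k')" by (simp add: real_sqrt_unique)
  thus "tan x = 1 / sqrt (sqrt (1 - k\<^sup>2))" by (simp add: k'_def real_sqrt_divide)
qed

lemma arsinh_tan_deriv:
  assumes "0 \<le> x" "x < pi / 2"
  shows "((\<lambda>x. arsinh (tan x)) has_real_derivative 1 / cos x) (at x)"
proof -
  have c: "0 < cos x" using assms by (intro cos_gt_zero_pi) auto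
  have "(tan x)\<^sup>2 + 1 = (1 / cos x)\<^sup>2"
    using c tan_sec[of x] by (simp add: power_divide inverse_eq_divide)
  hence "sqrt ((tan x)\<^sup>2 + 1) = 1 / cos x" using c by (simp add: real_sqrt_unique)
  moreover have "((\<lambda>x. arsinh (tan x)) has_real_derivative
      1 / sqrt ((tan x)\<^sup>2 + 1) * inverse ((cos x)\<^sup>2)) (at x)"
    using c by (intro DERIV_chain2[OF arsinh_real_has_field_derivative DERIV_tan]) auto
  ultimately show ?thesis using c by (simp add: power2_eq_square inverse_eq_divide)
qed

lemma arsinh_inverse_sqrt:
  assumes "0 < t" "t < 1"
  shows "ln (1 / t) / 2 \<le> arsinh (1 / sqrt t)" "arsinh (1 / sqrt t) \<le> ln (1 / t) / 2 + ln 3"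
proof -
  have eq: "sqrt ((1 / sqrt t)\<^sup>2 + 1) = sqrt (1 + t) / sqrt t"
    using assms by (simp add: power_divide real_sqrt_divide[symmetric] field_simps)
  have "arsinh (1 / sqrt t) = ln ((1 + sqrt (1 + t)) / sqrt t)"
    unfolding arsinh_real_def eq by (simp add: add_divide_distrib)
  also have "\<dots> = ln (1 + sqrt (1 + t)) + ln (1 / t) / 2"
    using assms add_pos_nonneg[of 1 "sqrt (1 + t)"]
    by (subst ln_div) (simp_all add: ln_sqrt ln_div)
  finally have *: "arsinh (1 / sqrt t) = ln (1 + sqrt (1 + t)) + ln (1 / t) / 2" .
  have "sqrt (1 + t) \<le> sqrt 4" using assms by (subst real_sqrt_le_iff) auto
  hence "sqrt (1 + t) \<le> 2" by simp
  moreover have "0 \<le> sqrt (1 + t)" using assms by simp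
  ultimately have "1 \<le> 1 + sqrt (1 + t)" "1 + sqrt (1 + t) \<le> 3" by auto
  note b = this
  have "0 \<le> ln (1 + sqrt (1 + t))" using b(1) by (rule ln_ge_zero)
  moreover have "ln (1 + sqrt (1 + t)) \<le> ln 3" using b by (intro ln_mono) linarith+
  ultimately have "0 \<le> ln (1 + sqrt (1 + t))" "ln (1 + sqrt (1 + t)) \<le> ln 3" by auto
  with * show "ln (1 / t) / 2 \<le> arsinh (1 / sqrt t)" "arsinh (1 / sqrt t) \<le> ln (1 / t) / 2 + ln 3"
    by auto
qed

text \<open>
  Half of \<open>K\<close> is \<open>F\<close> at the angle \<open>x\<close> with \<open>tan x = 1 / \<surd>k'\<close>. Up to this angle the integrand
  lies between \<open>1 / (2 cos)\<close> and \<open>1 / cos\<close>, whose antiderivative is \<open>arsinh \<circ> tan\<close>. This avoids the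
  region near \<open>\<pi> / 2\<close>, where \<open>1 / cos\<close> is not integrable.
\<close>
lemma elliptic_K_bounds:
  assumes k: "0 < k" "k < 1"
  defines "k' \<equiv> sqrt (1 - k\<^sup>2)"
  shows "ln (1 / k') / 2 \<le> elliptic_K k" "elliptic_K k \<le> ln (1 / k') + 2 * ln 3"
proof -
  note k' = complementary_modulus[OF k, folded k'_def]
  define x where "x = jacobi_am (elliptic_K k / 2) k"
  note x = tan_am_half_K[OF k, folded x_def k'_def]
  have Fx: "elliptic_F x k = elliptic_K k / 2" using k by (simp add: x_def)
  have d: "1 / sqrt (1 - k\<^sup>2 * (sin y)\<^sup>2) \<le> 1 / cos y" "1 / cos y \<le> 2 / sqrt (1 - k\<^sup>2 * (sin y)\<^sup>2)"
    if "0 \<le> y" "y \<le> x" for y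
  proof -
    have c: "0 < cos y" using that x by (intro cos_gt_zero_pi) auto
    have D: "0 < sqrt (1 - k\<^sup>2 * (sin y)\<^sup>2)" using sqrt_delta(1)[OF k] .
    have eq: "1 - k\<^sup>2 * (sin y)\<^sup>2 = (cos y)\<^sup>2 + k'\<^sup>2 * (sin y)\<^sup>2"
      by (simp add: cos_squared_eq k'(3) left_diff_distrib)
    hence "sqrt ((cos y)\<^sup>2) \<le> sqrt (1 - k\<^sup>2 * (sin y)\<^sup>2)"
      by (subst real_sqrt_le_iff) auto
    hence c1: "cos y \<le> sqrt (1 - k\<^sup>2 * (sin y)\<^sup>2)" using c by simp
    have tan: "0 \<le> tan y" "tan y \<le> tan x"
      using that x(2) tan_mono_le[of 0 y] tan_mono_le[of y x] by auto
    have "(tan y)\<^sup>2 \<le> (tan x)\<^sup>2" using tan by (intro power_mono)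
    also have "\<dots> = 1 / k'" using k' by (simp add: x(3) power_divide)
    finally have "k'\<^sup>2 * (tan y)\<^sup>2 \<le> k'\<^sup>2 * (1 / k')" by (intro mult_left_mono) auto
    also have "\<dots> \<le> 1" using k'(1,2) by (simp only: power2_eq_square) simp
    finally have "k'\<^sup>2 * (tan y)\<^sup>2 * (cos y)\<^sup>2 \<le> 1 * (cos y)\<^sup>2" by (intro mult_right_mono) auto
    hence "k'\<^sup>2 * (sin y)\<^sup>2 \<le> (cos y)\<^sup>2" using c by (simp add: tan_def power_divide)
    hence "(cos y)\<^sup>2 + k'\<^sup>2 * (sin y)\<^sup>2 \<le> 2\<^sup>2 * (cos y)\<^sup>2"
      using zero_le_power2[of "cos y"] unfolding power2_eq_square[of "2::real"] by linarith
    hence c2: "sqrt (1 - k\<^sup>2 * (sin y)\<^sup>2) \<le> 2 * cos y"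
      unfolding eq using c by (intro real_le_lsqrt) (simp_all add: power_mult_distrib)
    show "1 / sqrt (1 - k\<^sup>2 * (sin y)\<^sup>2) \<le> 1 / cos y" "1 / cos y \<le> 2 / sqrt (1 - k\<^sup>2 * (sin y)\<^sup>2)"
      using divide_left_mono[OF c1, of 1] divide_left_mono[OF c2, of 2] c D by auto
  qed
  have "arsinh (tan 0) - elliptic_F 0 k \<le> arsinh (tan x) - elliptic_F x k"
  proof (rule DERIV_nonneg_imp_nondecreasing[where f = "\<lambda>x. arsinh (tan x) - elliptic_F x k"])
    fix y assume y: "0 \<le> y" "y \<le> x"
    show "\<exists>D. ((\<lambda>x. arsinh (tan x) - elliptic_F x k) has_real_derivative D) (at y) \<and> 0 \<le> D"
      using d(1)[OF y] y x(2)
      by (intro exI[of _ "1 / cos y - 1 / sqrt (1 - k\<^sup>2 * (sin y)\<^sup>2)"] conjI DERIV_diff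
            arsinh_tan_deriv elliptic_F_deriv k) auto
  qed (use x in auto)
  thus "elliptic_K k \<le> ln (1 / k') + 2 * ln 3"
    using arsinh_inverse_sqrt(2)[of k'] k k' by (simp add: Fx x(3))
  have "2 * elliptic_F 0 k - arsinh (tan 0) \<le> 2 * elliptic_F x k - arsinh (tan x)"
  proof (rule DERIV_nonneg_imp_nondecreasing[where f = "\<lambda>x. 2 * elliptic_F x k - arsinh (tan x)"])
    fix y assume y: "0 \<le> y" "y \<le> x"
    show "\<exists>D. ((\<lambda>x. 2 * elliptic_F x k - arsinh (tan x)) has_real_derivative D) (at y) \<and> 0 \<le> D"
      using d(2)[OF y] y x(2)
      by (intro exI[of _ "2 * (1 / sqrt (1 - k\<^sup>2 * (sin y)\<^sup>2)) - 1 / cos y"] conjI DERIV_diff DERIV_cmult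
            arsinh_tan_deriv elliptic_F_deriv k) auto
  qed (use x in auto)
  thus "ln (1 / k') / 2 \<le> elliptic_K k"
    using arsinh_inverse_sqrt(1)[of k'] k k' by (simp add: Fx x(3))
qed

lemma elliptic_K_le:
  assumes k: "0 < k" "k < 1"
  shows "elliptic_K k \<le> pi / 2 / sqrt (1 - k\<^sup>2)"
proof -
  note k' = complementary_modulus[OF k]
  have "0 / sqrt (1 - k\<^sup>2) - elliptic_F 0 k \<le> (pi / 2) / sqrt (1 - k\<^sup>2) - elliptic_F (pi / 2) k"
  proof (rule DERIV_nonneg_imp_nondecreasing[where f = "\<lambda>x. x / sqrt (1 - k\<^sup>2) - elliptic_F x k"])
    fix y :: real
    have "(sin y)\<^sup>2 \<le> 1" by (simp add: abs_square_le_1)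
    hence "k\<^sup>2 * (sin y)\<^sup>2 \<le> k\<^sup>2" by (simp add: mult_left_le)
    hence "1 / sqrt (1 - k\<^sup>2 * (sin y)\<^sup>2) \<le> 1 / sqrt (1 - k\<^sup>2)"
      using k' by (intro divide_left_mono mult_pos_pos sqrt_delta[OF k]) auto
    thus "\<exists>D. ((\<lambda>x. x / sqrt (1 - k\<^sup>2) - elliptic_F x k) has_real_derivative D) (at y) \<and> 0 \<le> D"
      by (intro exI[of _ "1 / sqrt (1 - k\<^sup>2) - 1 / sqrt (1 - k\<^sup>2 * (sin y)\<^sup>2)"] conjI DERIV_diff
            elliptic_F_deriv k DERIV_cdivide DERIV_ident) auto
  qed simp
  thus ?thesis using k by (simp add: elliptic_K_def)
qed

section \<open>Products of the elliptic sine over an equidistant grid\<close>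

text \<open>The factors \<open>\<surd>k\<close> make the Landen transformation act on the product without a constant.\<close>
definition sn_grid :: "real \<Rightarrow> nat \<Rightarrow> real \<Rightarrow> real"
  where "sn_grid k n u = (\<Prod>j<n. sqrt k * \<bar>jacobi_sn (u + 2 * elliptic_K k * real j / real n) k\<bar>)"

lemma prod_lessThan_add: "(\<Prod>j<m + n. f j) = (\<Prod>j<m. f j) * (\<Prod>j<n. f (m + j))"
  for f :: "nat \<Rightarrow> 'a::comm_monoid_mult"
  by (induction n) (simp_all add: mult.assoc)

lemma prod_even_odd: "(\<Prod>j<2 * n. f j) = (\<Prod>j<n. f (2 * j)) * (\<Prod>j<n. f (2 * j + 1))"
  for f :: "nat \<Rightarrow> 'a::comm_monoid_mult"
  by (induction n) (simp_all add: ac_simps)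

context
  fixes k :: real
  assumes k: "0 < k" "k < 1"
begin

lemma abs_sn_add_2K: "\<bar>jacobi_sn (u + 2 * elliptic_K k) k\<bar> = \<bar>jacobi_sn u k\<bar>"
  by (simp add: sn_add_2K[OF k])

lemma abs_sn_2K_diff: "\<bar>jacobi_sn (2 * elliptic_K k - u) k\<bar> = \<bar>jacobi_sn u k\<bar>"
  using abs_sn_add_2K[of "- u"] by (simp add: sn_uminus[OF k] algebra_simps)

lemma abs_sn_le:
  assumes "\<bar>w\<bar> \<le> h" "h \<le> elliptic_K k" "h \<le> v" "v \<le> 2 * elliptic_K k - h"
  shows "\<bar>jacobi_sn w k\<bar> \<le> \<bar>jacobi_sn v k\<bar>"
proof -
  have h: "0 \<le> h" using assms by simp
  have "\<bar>jacobi_sn w k\<bar> = \<bar>jacobi_sn \<bar>w\<bar> k\<bar>" by (auto simp: abs_if sn_uminus[OF k])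
  also have "\<dots> = jacobi_sn \<bar>w\<bar> k"
    using sn_mono[OF k, of 0 "\<bar>w\<bar>"] assms k by simp
  also have "\<dots> \<le> jacobi_sn h k" using assms by (intro sn_mono[OF k]) auto
  also have "\<dots> \<le> \<bar>jacobi_sn v k\<bar>"
  proof (cases "v \<le> elliptic_K k")
    case True
    hence "jacobi_sn h k \<le> jacobi_sn v k" using h assms by (intro sn_mono[OF k]) auto
    thus ?thesis by simp
  next
    case False
    hence "jacobi_sn h k \<le> jacobi_sn (2 * elliptic_K k - v) k"
      using h assms by (intro sn_mono[OF k]) auto
    thus ?thesis using abs_sn_2K_diff[of v] by simp
  qed
  finally show ?thesis .
qed

text \<open>
  By the addition theorem the product is \<open>(B - A) / (1 - k\<^sup>2 A B)\<close> with \<open>A = sn\<^sup>2 w\<close>, \<open>B = sn\<^sup>2 v\<close>,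
  which decreases in \<open>A\<close>.
\<close>
lemma sn_prod_antimono:
  assumes "\<bar>jacobi_sn w k\<bar> \<le> \<bar>jacobi_sn w' k\<bar>" "\<bar>jacobi_sn w' k\<bar> \<le> \<bar>jacobi_sn v k\<bar>"
  shows "\<bar>jacobi_sn (v + w') k * jacobi_sn (v - w') k\<bar> \<le> \<bar>jacobi_sn (v + w) k * jacobi_sn (v - w) k\<bar>"
proof -
  define A A' B where defs: "A = (jacobi_sn w k)\<^sup>2" "A' = (jacobi_sn w' k)\<^sup>2" "B = (jacobi_sn v k)\<^sup>2"
  have AB: "0 \<le> A" "A \<le> A'" "A' \<le> B" "B \<le> 1" "0 \<le> B"
    using assms abs_sn_le_1[OF k, of v] by (auto simp: defs abs_le_square_iff abs_square_le_1)
  have E: "0 < 1 - k\<^sup>2 * B * A" "0 < 1 - k\<^sup>2 * B * A'"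
    using sn_denom_pos[OF k] by (simp_all add: defs)
  have "k\<^sup>2 * B\<^sup>2 \<le> 1" using AB k by (intro mult_le_one) (auto simp: power_le_one)
  hence "0 \<le> (A' - A) * (1 - k\<^sup>2 * B\<^sup>2)" using AB by (intro mult_nonneg_nonneg) auto
  hence "(B - A') * (1 - k\<^sup>2 * B * A) \<le> (B - A) * (1 - k\<^sup>2 * B * A')"
    by (simp add: algebra_simps power2_eq_square)
  hence "(B - A') / (1 - k\<^sup>2 * B * A') \<le> (B - A) / (1 - k\<^sup>2 * B * A)"
    using E by (simp add: divide_simps mult.commute)
  moreover have "0 \<le> (B - A') / (1 - k\<^sup>2 * B * A')" "0 \<le> (B - A) / (1 - k\<^sup>2 * B * A)"
    using AB E by auto
  ultimately show ?thesis
    unfolding sn_add_mult_sn_diff[OF k] defs[symmetric] by (simp only: abs_of_nonneg)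
qed

context
  fixes n :: nat
  assumes n: "0 < n"
begin

lemma sn_grid_nonneg: "0 \<le> sn_grid k n u"
  using k by (auto simp: sn_grid_def intro!: prod_nonneg)

lemma sn_grid_shift: "sn_grid k n (u + 2 * elliptic_K k / n) = sn_grid k n u"
proof -
  obtain m where m: "n = Suc m" using n by (cases n) auto
  define a where "a j = sqrt k * \<bar>jacobi_sn (u + 2 * elliptic_K k * real j / n) k\<bar>" for j
  have an: "a n = a 0" using n by (simp add: a_def abs_sn_add_2K)
  have "sn_grid k n (u + 2 * elliptic_K k / n) = (\<Prod>j<n. a (Suc j))"
    unfolding sn_grid_def a_def using n by (intro prod.cong) (simp_all add: field_simps)
  also have "\<dots> = (\<Prod>j<m. a (Suc j)) * a 0" using an by (simp add: m)
  also have "\<dots> = (\<Prod>j<n. a j)" unfolding m prod.lessThan_Suc_shift by (simp add: mult.commute)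
  finally show ?thesis by (simp add: sn_grid_def a_def)
qed

lemma sn_grid_shift_int: "sn_grid k n (u + 2 * elliptic_K k / n * of_int i) = sn_grid k n u"
proof -
  define c where "c = 2 * elliptic_K k / n"
  have shift: "sn_grid k n (v + c) = sn_grid k n v" for v
    using sn_grid_shift by (simp add: c_def)
  have "sn_grid k n (u + c * of_int i) = sn_grid k n u"
  proof (induction i rule: int_induct[of _ 0])
    case (step1 i)
    thus ?case using shift[of "u + c * of_int i"] by (simp add: algebra_simps)
  next
    case (step2 i)
    thus ?case using shift[of "u + c * of_int (i - 1)"] by (simp add: algebra_simps)
  qed simp
  thus ?thesis by (simp add: c_def)
qed

lemma sn_grid_uminus: "sn_grid k n (- u) = sn_grid k n u"
proof -
  define g where "g j = sqrt k * \<bar>jacobi_sn (u + 2 * elliptic_K k / n + 2 * elliptic_K k * real j / n) k\<bar>" for j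
  have "sn_grid k n (- u) = (\<Prod>j<n. g (n - Suc j))"
    unfolding sn_grid_def
  proof (intro prod.cong refl)
    fix j assume "j \<in> {..<n}"
    hence j: "real (n - Suc j) = real n - 1 - real j" by auto
    have eq: "2 * elliptic_K k - (- u + 2 * elliptic_K k * real j / n)
        = u + 2 * elliptic_K k / n + 2 * elliptic_K k * real (n - Suc j) / n"
      unfolding j using n by (simp add: field_simps)
    show "sqrt k * \<bar>jacobi_sn (- u + 2 * elliptic_K k * real j / n) k\<bar> = g (n - Suc j)"
      using abs_sn_2K_diff[of "- u + 2 * elliptic_K k * real j / n", unfolded eq] by (simp only: g_def)
  qed
  also have "\<dots> = (\<Prod>j<n. g j)" by (rule prod.nat_diff_reindex)
  also have "\<dots> = sn_grid k n (u + 2 * elliptic_K k / n)" by (simp add: sn_grid_def g_def)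
  finally show ?thesis by (simp add: sn_grid_shift)
qed

text \<open>
  After a shift by a multiple of the grid width, the argument is \<open>h + w\<close> with \<open>h = K / n\<close> and
  \<open>\<bar>w\<bar> \<le> h\<close>. The grid is symmetric, so the square of the product consists of the pairs
  \<open>sn (v\<^sub>j + w) * sn (v\<^sub>j - w)\<close>, each of which is largest at \<open>w = 0\<close>.
\<close>
lemma sn_grid_max: "sn_grid k n u \<le> sn_grid k n (elliptic_K k / n)"
proof -
  define h where "h = elliptic_K k / n"
  have h: "0 < h" "h \<le> elliptic_K k" "n * h = elliptic_K k"
    using n elliptic_K_pos[OF k] by (auto simp: h_def field_simps)
  define i where "i = \<lfloor>u / (2 * h)\<rfloor>"
  define w where "w = u - h - 2 * h * of_int i"
  have "of_int i \<le> u / (2 * h)" "u / (2 * h) \<le> of_int i + 1" unfolding i_def by linarith+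
  hence "of_int i * (2 * h) \<le> u" "u \<le> (of_int i + 1) * (2 * h)"
    using h by (simp_all add: pos_le_divide_eq pos_divide_le_eq)
  hence w: "\<bar>w\<bar> \<le> h" by (simp add: w_def abs_le_iff algebra_simps)
  define v where "v j = h + 2 * elliptic_K k * real j / n" for j
  have vh: "v j = (2 * real j + 1) * h" for j using n by (simp add: v_def h_def field_simps)
  have grid: "sn_grid k n (h + x) * sn_grid k n (h - x)
      = (\<Prod>j<n. (sqrt k)\<^sup>2 * \<bar>jacobi_sn (v j + x) k * jacobi_sn (v j - x) k\<bar>)" for x
  proof -
    have a: "h + x + 2 * elliptic_K k * real j / n = v j + x"
      "h - x + 2 * elliptic_K k * real j / n = v j - x" for j
      by (simp_all add: v_def)
    show ?thesis unfolding sn_grid_def prod.distrib[symmetric] a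
      by (intro prod.cong refl) (simp only: abs_mult power2_eq_square mult_ac)
  qed
  have eq: "sn_grid k n u = sn_grid k n (h + w)"
    using sn_grid_shift_int[of "h + w" i] by (simp add: w_def h_def)
  have "sn_grid k n (h - w) = sn_grid k n (w - h)"
    using sn_grid_uminus[of "w - h"] by simp
  also have "\<dots> = sn_grid k n (h + w)"
    using sn_grid_shift[of "w - h"] by (simp add: h_def algebra_simps)
  finally have "(sn_grid k n u)\<^sup>2 = sn_grid k n (h + w) * sn_grid k n (h - w)"
    by (simp add: eq power2_eq_square)
  also have "\<dots> = (\<Prod>j<n. (sqrt k)\<^sup>2 * \<bar>jacobi_sn (v j + w) k * jacobi_sn (v j - w) k\<bar>)"
    by (rule grid)
  also have "\<dots> \<le> (\<Prod>j<n. (sqrt k)\<^sup>2 * \<bar>jacobi_sn (v j + 0) k * jacobi_sn (v j - 0) k\<bar>)"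
  proof (intro prod_mono conjI mult_left_mono sn_prod_antimono)
    fix j assume j: "j \<in> {..<n}"
    hence "real j + 1 \<le> n" by simp
    hence "(2 * real j + 1) * h \<le> (2 * real n - 1) * h" using h by (intro mult_right_mono) auto
    also have "\<dots> = 2 * elliptic_K k - h" using h(3) by (simp add: algebra_simps)
    finally show "\<bar>jacobi_sn w k\<bar> \<le> \<bar>jacobi_sn (v j) k\<bar>"
      using w h by (intro abs_sn_le[of _ h]) (auto simp: vh)
    show "\<bar>jacobi_sn 0 k\<bar> \<le> \<bar>jacobi_sn w k\<bar>" using k by simp
  qed (use k in auto)
  also have "\<dots> = (sn_grid k n h)\<^sup>2"
    unfolding grid[symmetric] by (simp add: power2_eq_square)
  finally show ?thesis unfolding h_def by (rule power2_le_imp_le) (rule sn_grid_nonneg)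
qed

text \<open>
  Halving the distance to the nearest zero halves the factor of this zero at most. The product \<open>R\<close>
  of all other factors increases on the way to that zero, by the same pairing as before.
\<close>
lemma sn_grid_halve: "sn_grid k n (elliptic_K k / n) \<le> 2 * sn_grid k n (elliptic_K k / (2 * n))"
proof -
  obtain m where m: "n = Suc m" using n by (cases n) auto
  define h where "h = elliptic_K k / (2 * n)"
  have h: "0 < h" "2 * n * h = elliptic_K k" using n elliptic_K_pos[OF k] by (auto simp: h_def)
  have h2: "2 * h \<le> elliptic_K k"
  proof -
    have "2 * h \<le> 2 * real n * h" using n h(1) by simp
    thus ?thesis using h(2) by simp
  qed
  define b where "b j = 2 * elliptic_K k * real (Suc j) / n" for j
  define R where "R u = (\<Prod>j<m. sqrt k * \<bar>jacobi_sn (u + b j) k\<bar>)" for u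
  have grid: "sn_grid k n u = sqrt k * \<bar>jacobi_sn u k\<bar> * R u" for u
    unfolding sn_grid_def m prod.lessThan_Suc_shift by (simp add: R_def b_def m)
  have Rneg: "R (- u) = R u" for u
  proof -
    define g where "g j = sqrt k * \<bar>jacobi_sn (u + b j) k\<bar>" for j
    have "R (- u) = (\<Prod>j<m. g (m - Suc j))"
      unfolding R_def
    proof (intro prod.cong refl)
      fix j assume "j \<in> {..<m}"
      hence j: "real (Suc (m - Suc j)) = real n - real (Suc j)" by (auto simp: m)
      have eq: "2 * elliptic_K k - (- u + b j) = u + b (m - Suc j)"
        unfolding b_def j using n by (simp add: field_simps)
      show "sqrt k * \<bar>jacobi_sn (- u + b j) k\<bar> = g (m - Suc j)"
        using abs_sn_2K_diff[of "- u + b j", unfolded eq] by (simp only: g_def)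
    qed
    also have "\<dots> = (\<Prod>j<m. g j)" by (rule prod.nat_diff_reindex)
    finally show ?thesis by (simp add: R_def g_def)
  qed
  have Rsq: "(R u)\<^sup>2 = (\<Prod>j<m. (sqrt k)\<^sup>2 * \<bar>jacobi_sn (b j + u) k * jacobi_sn (b j - u) k\<bar>)" for u
  proof -
    have "(R u)\<^sup>2 = R u * R (- u)" by (simp add: Rneg power2_eq_square)
    moreover have "u + b j = b j + u" "- u + b j = b j - u" for j by simp_all
    ultimately show ?thesis unfolding R_def prod.distrib[symmetric]
      by (simp only: abs_mult power2_eq_square mult_ac)
  qed
  have Rpos: "0 \<le> R u" for u using k by (auto simp: R_def intro!: prod_nonneg)
  have "(R (2 * h))\<^sup>2 \<le> (R h)\<^sup>2"
    unfolding Rsq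
  proof (intro prod_mono conjI mult_left_mono sn_prod_antimono)
    fix j assume "j \<in> {..<m}"
    hence j: "real (Suc j) \<le> real n - 1" by (simp add: m)
    have b: "b j = real (Suc j) * (4 * h)" using n by (simp add: b_def h_def field_simps)
    have "4 * h * 1 \<le> 4 * h * real (Suc j)" using h by (intro mult_left_mono) auto
    moreover have "4 * h * real (Suc j) \<le> 4 * h * (real n - 1)" using h j by (intro mult_left_mono) auto
    moreover have "4 * h * (real n - 1) = 2 * elliptic_K k - 4 * h" using h(2) by (simp add: algebra_simps)
    ultimately have "4 * h \<le> b j" "b j \<le> 2 * elliptic_K k - 4 * h"
      by (simp_all only: b mult.commute)
    thus "\<bar>jacobi_sn (2 * h) k\<bar> \<le> \<bar>jacobi_sn (b j) k\<bar>"
      using h h2 by (intro abs_sn_le[of _ "2 * h"]) auto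
    show "\<bar>jacobi_sn h k\<bar> \<le> \<bar>jacobi_sn (2 * h) k\<bar>"
      using h h2 by (intro abs_sn_le[of _ h]) auto
  qed (use k in auto)
  hence R: "R (2 * h) \<le> R h" using Rpos by (rule power2_le_imp_le)
  have "0 \<le> jacobi_sn h k" "0 \<le> jacobi_sn (2 * h) k"
    using sn_mono[OF k, of 0 h] sn_mono[OF k, of 0 "2 * h"] h h2 k by auto
  moreover have "jacobi_sn (2 * h) k \<le> 2 * jacobi_sn h k" using h h2 by (intro sn_double_le[OF k]) auto
  ultimately have "\<bar>jacobi_sn (2 * h) k\<bar> \<le> 2 * \<bar>jacobi_sn h k\<bar>" by simp
  hence "sqrt k * \<bar>jacobi_sn (2 * h) k\<bar> * R (2 * h) \<le> sqrt k * (2 * \<bar>jacobi_sn h k\<bar>) * R h"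
    using R Rpos k by (intro mult_mono mult_left_mono) auto
  thus ?thesis unfolding grid[symmetric] using grid[of h] by (simp add: h_def)
qed

lemma sn_grid_double: "sn_grid k (2 * n) u = sn_grid k n u * sn_grid k n (u + elliptic_K k / n)"
proof -
  have eq: "u + 2 * elliptic_K k * real (2 * j) / real (2 * n) = u + 2 * elliptic_K k * real j / n"
    "u + 2 * elliptic_K k * real (2 * j + 1) / real (2 * n)
      = u + elliptic_K k / n + 2 * elliptic_K k * real j / n" for j
    using n by (simp_all add: field_simps)
  show ?thesis unfolding sn_grid_def prod_even_odd eq by (rule refl)
qed

lemma sn_grid_double_mid:
  "sn_grid k (2 * n) (elliptic_K k / (2 * n)) = (sn_grid k n (elliptic_K k / (2 * n)))\<^sup>2"
proof -
  define h where "h = elliptic_K k / (2 * n)"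
  have "sn_grid k n (h + elliptic_K k / n) = sn_grid k n (- h + 2 * elliptic_K k / n)"
    using n by (simp add: h_def field_simps)
  also have "\<dots> = sn_grid k n h" by (simp only: sn_grid_shift sn_grid_uminus)
  finally show ?thesis by (simp add: sn_grid_double power2_eq_square h_def)
qed

text \<open>
  Grid points at distance \<open>K\<close> are paired: \<open>k sn v * sn (v + K) = k sn v * cn v / dn v\<close> is
  \<open>\<surd>l * sn ((1 + k') v, l)\<close> for the descended modulus \<open>l\<close>.
\<close>
lemma sn_grid_landen: "sn_grid k (2 * n) u = sn_grid (landen k) n ((1 + sqrt (1 - k\<^sup>2)) * u)"
proof -
  define k' where "k' = sqrt (1 - k\<^sup>2)"
  note k' = complementary_modulus[OF k, folded k'_def]
  have l: "0 < landen k" using landen_bounds[OF k] by simp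
  have "landen k * (1 + k') = 1 - k'"
    using k' by (simp add: landen_def k'_def[symmetric] field_simps)
  hence "landen k * (1 + k')\<^sup>2 = k\<^sup>2" using k'(3) by algebra
  hence "sqrt (landen k * (1 + k')\<^sup>2) = sqrt (k\<^sup>2)" by simp
  hence sl: "sqrt (landen k) * (1 + k') = k" using k k' by (simp add: real_sqrt_mult)
  have step: "(sqrt k * \<bar>jacobi_sn v k\<bar>) * (sqrt k * \<bar>jacobi_sn (v + elliptic_K k) k\<bar>)
      = sqrt (landen k) * \<bar>jacobi_sn ((1 + k') * v) (landen k)\<bar>" for v
  proof -
    define X where "X = jacobi_sn v k * jacobi_cn v k / jacobi_dn v k"
    have "(sqrt k * \<bar>jacobi_sn v k\<bar>) * (sqrt k * \<bar>jacobi_sn (v + elliptic_K k) k\<bar>) = k * \<bar>X\<bar>"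
      using k by (simp add: sn_add_K[OF k] abs_mult X_def)
    also have "\<dots> = sqrt (landen k) * (1 + k') * \<bar>X\<bar>" by (simp only: sl)
    also have "\<dots> = sqrt (landen k) * \<bar>(1 + k') * X\<bar>"
      using k'(1) by (simp add: abs_mult)
    also have "(1 + k') * X = (1 + k') * jacobi_sn v k * jacobi_cn v k / jacobi_dn v k"
      by (simp add: X_def)
    finally show ?thesis by (simp only: descending_landen(1)[OF k, folded k'_def])
  qed
  have "sn_grid k (2 * n) u = (\<Prod>j<n + n. sqrt k * \<bar>jacobi_sn (u + elliptic_K k * real j / n) k\<bar>)"
    unfolding sn_grid_def mult_2 using n by (intro prod.cong) (simp_all add: field_simps)
  also have "\<dots> = (\<Prod>j<n. (sqrt k * \<bar>jacobi_sn (u + elliptic_K k * real j / n) k\<bar>) *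
      (sqrt k * \<bar>jacobi_sn (u + elliptic_K k * real j / n + elliptic_K k) k\<bar>))"
    unfolding prod_lessThan_add prod.distrib[symmetric] using n
    by (intro prod.cong) (simp_all add: field_simps)
  also have "\<dots> = (\<Prod>j<n. sqrt (landen k) *
      \<bar>jacobi_sn ((1 + k') * u + 2 * elliptic_K (landen k) * real j / n) (landen k)\<bar>)"
    unfolding step elliptic_K_landen[OF k, symmetric] k'_def[symmetric]
    by (simp add: field_simps)
  finally show ?thesis by (simp add: sn_grid_def k'_def)
qed

lemma sn_grid_mid_le: "sn_grid k n (elliptic_K k / n) \<le> exp (n / 2 * ln k)"
proof -
  have "sn_grid k n (elliptic_K k / n) \<le> (\<Prod>j<n. sqrt k)"
    unfolding sn_grid_def using k abs_sn_le_1[OF k] by (intro prod_mono) (auto simp: mult_left_le)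
  also have "\<dots> = exp (ln (sqrt k)) ^ n" using k by simp
  also have "\<dots> = exp (n / 2 * ln k)"
    using k by (simp only: exp_of_nat_mult[symmetric] ln_sqrt) (simp add: mult.commute)
  finally show ?thesis .
qed

end

lemma sn_grid_landen_mid:
  assumes n: "0 < n"
  shows "(sn_grid k n (elliptic_K k / n))\<^sup>2 \<le> 4 * sn_grid (landen k) n (elliptic_K (landen k) / n)"
proof -
  have "(sn_grid k n (elliptic_K k / n))\<^sup>2 \<le> (2 * sn_grid k n (elliptic_K k / (2 * n)))\<^sup>2"
    by (intro power_mono sn_grid_halve sn_grid_nonneg n)
  also have "\<dots> = 4 * sn_grid k (2 * n) (elliptic_K k / (2 * n))"
    using sn_grid_double_mid[OF n] by (simp add: power_mult_distrib)
  also have "\<dots> = 4 * sn_grid (landen k) n ((1 + sqrt (1 - k\<^sup>2)) * (elliptic_K k / (2 * n)))"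
    by (simp only: sn_grid_landen[OF n])
  also have "(1 + sqrt (1 - k\<^sup>2)) * (elliptic_K k / (2 * n)) = elliptic_K (landen k) / n"
    using elliptic_K_landen[OF k] n by (simp add: field_simps)
  finally show ?thesis .
qed

text \<open>\<open>K' \<le> ln (1 / k) + 2 ln 3\<close>, and \<open>K \<ge> \<pi> / 2\<close> makes \<open>log_nome k\<close> at most \<open>K'\<close>.\<close>
lemma ln_modulus_le: "ln k \<le> 2 * ln 3 - log_nome k"
proof -
  note k' = complementary_modulus[OF k]
  have "sqrt (1 - (sqrt (1 - k\<^sup>2))\<^sup>2) = k" unfolding k'(3) using k by simp
  hence "elliptic_K (sqrt (1 - k\<^sup>2)) \<le> ln (1 / k) + 2 * ln 3"
    using elliptic_K_bounds(2)[OF k'(1,2)] by simp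
  moreover have "log_nome k \<le> elliptic_K (sqrt (1 - k\<^sup>2))"
  proof -
    have "pi / 2 * elliptic_K (sqrt (1 - k\<^sup>2)) \<le> elliptic_K k * elliptic_K (sqrt (1 - k\<^sup>2))"
      using elliptic_K_ge[OF k] elliptic_K_pos[OF k'(1,2)] by (intro mult_right_mono) auto
    thus ?thesis using elliptic_K_pos[OF k] by (simp add: log_nome_def field_simps)
  qed
  ultimately show ?thesis using k by (simp add: ln_div)
qed

end

text \<open>
  One Landen step takes a square root of the bound for the descended modulus. This halves the error
  term, reproduces the factor \<open>4 = \<surd>(4 * 4)\<close> and, since \<open>log_nome\<close> doubles, the main term.
\<close>
lemma sn_grid_mid_approx:
  assumes "0 < n" "0 < k" "k < 1"
  shows "sn_grid k n (elliptic_K k / n) \<le> 4 * exp (n / 2 * (2 * ln 3 / 2 ^ m - log_nome k))"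
  using assms(2,3)
proof (induction m arbitrary: k)
  case 0
  have "sn_grid k n (elliptic_K k / n) \<le> exp (n / 2 * ln k)"
    using sn_grid_mid_le[OF 0 assms(1)] .
  also have "\<dots> \<le> exp (n / 2 * (2 * ln 3 - log_nome k))"
    using ln_modulus_le[OF 0] by (simp add: mult_left_mono)
  also have "\<dots> \<le> 4 * \<dots>" by simp
  finally show ?case by simp
next
  case (Suc m)
  have "(sn_grid k n (elliptic_K k / n))\<^sup>2 \<le> 4 * sn_grid (landen k) n (elliptic_K (landen k) / n)"
    by (rule sn_grid_landen_mid[OF Suc.prems assms(1)])
  also have "\<dots> \<le> 4 * (4 * exp (n / 2 * (2 * ln 3 / 2 ^ m - log_nome (landen k))))"
    using landen_bounds[OF Suc.prems] by (intro mult_left_mono Suc.IH) auto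
  also have "\<dots> = 16 * exp (2 * (n / 2 * (2 * ln 3 / 2 ^ Suc m - log_nome k)))"
    unfolding log_nome_landen[OF Suc.prems] by (simp add: field_simps)
  also have "\<dots> = (4 * exp (n / 2 * (2 * ln 3 / 2 ^ Suc m - log_nome k)))\<^sup>2"
    unfolding exp_double power_mult_distrib by simp
  finally show ?case by (rule power2_le_imp_le) simp
qed

lemma sn_grid_le:
  assumes "0 < n" "0 < k" "k < 1"
  shows "sn_grid k n u \<le> 4 * exp (- (n / 2 * log_nome k))"
proof -
  have lim: "(\<lambda>m. 4 * exp (n / 2 * (2 * ln 3 * (1 / 2) ^ m - log_nome k)))
      \<longlonglongrightarrow> 4 * exp (n / 2 * (2 * ln 3 * 0 - log_nome k))"
    by (intro tendsto_intros LIMSEQ_power_zero) simp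
  have bound: "sn_grid k n (elliptic_K k / n) \<le> 4 * exp (n / 2 * (2 * ln 3 * (1 / 2) ^ m - log_nome k))" for m
    using sn_grid_mid_approx[OF assms, of m] by (simp add: power_one_over)
  have "sn_grid k n (elliptic_K k / n) \<le> 4 * exp (n / 2 * (2 * ln 3 * 0 - log_nome k))"
    by (rule LIMSEQ_le_const[OF lim]) (use bound in blast)
  thus ?thesis using sn_grid_max[OF assms(2,3,1), of u] by (simp add: algebra_simps)
qed

section \<open>The Zolotarev points and the constant \<open>C\<^sup>*\<close>\<close>

text \<open>
  Ascending from this modulus leads to \<open>\<surd>(1 - \<delta>\<^sup>2)\<close>, the modulus of the Zolotarev points; descending
  from it leads to the modulus \<open>((1 - \<surd>\<delta>) / (1 + \<surd>\<delta>))\<^sup>2\<close> in the definition of \<open>C\<^sup>*\<close>.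
\<close>
definition zolotarev_modulus :: "real \<Rightarrow> real"
  where "zolotarev_modulus \<delta> = (1 - \<delta>) / (1 + \<delta>)"

lemma zolotarev_modulus_props:
  assumes "0 < \<delta>" "\<delta> < 1"
  shows "0 < zolotarev_modulus \<delta>" "zolotarev_modulus \<delta> < 1"
    and "(sqrt (1 - \<delta>\<^sup>2))\<^sup>2 * (1 + zolotarev_modulus \<delta>)\<^sup>2 = 4 * zolotarev_modulus \<delta>"
    and "sqrt (1 - (zolotarev_modulus \<delta>)\<^sup>2) = 2 * sqrt \<delta> / (1 + \<delta>)"
proof -
  define l where "l = zolotarev_modulus \<delta>"
  have l: "l * (1 + \<delta>) = 1 - \<delta>" using assms by (simp add: l_def zolotarev_modulus_def)
  have l1: "(1 + l) * (1 + \<delta>) = 2" using l by algebra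
  show "0 < zolotarev_modulus \<delta>" "zolotarev_modulus \<delta> < 1"
    using assms by (auto simp: zolotarev_modulus_def)
  have "(1 - \<delta>\<^sup>2) * (1 + l)\<^sup>2 = 4 * l" using l l1 by algebra
  thus "(sqrt (1 - \<delta>\<^sup>2))\<^sup>2 * (1 + zolotarev_modulus \<delta>)\<^sup>2 = 4 * zolotarev_modulus \<delta>"
    by (simp only: complementary_modulus(3)[OF assms] l_def)
  have "(1 - l\<^sup>2) * (1 + \<delta>)\<^sup>2 = 4 * \<delta>" using l by algebra
  hence "1 - l\<^sup>2 = 4 * \<delta> / (1 + \<delta>)\<^sup>2" using assms by (simp add: eq_divide_eq)
  hence "1 - l\<^sup>2 = (2 * sqrt \<delta> / (1 + \<delta>))\<^sup>2" using assms by (simp add: power_divide power_mult_distrib)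
  thus "sqrt (1 - (zolotarev_modulus \<delta>)\<^sup>2) = 2 * sqrt \<delta> / (1 + \<delta>)"
    using assms by (simp add: l_def)
qed

lemma C_star_eq_log_nome:
  assumes \<delta>: "0 < \<delta>" "\<delta> < 1"
  shows "C_star \<delta> = log_nome (zolotarev_modulus \<delta>)"
proof -
  note l = zolotarev_modulus_props[OF \<delta>]
  define w where "w = sqrt \<delta>"
  have w: "0 < w" "w\<^sup>2 = \<delta>" using \<delta> by (simp_all add: w_def)
  have "(1 - 2 * w / (1 + \<delta>)) / (1 + 2 * w / (1 + \<delta>)) = (1 + \<delta> - 2 * w) / (1 + \<delta> + 2 * w)"
  proof -
    have nz: "1 + \<delta> \<noteq> 0" using \<delta> by simp
    have "1 - 2 * w / (1 + \<delta>) = (1 + \<delta> - 2 * w) / (1 + \<delta>)"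
      "1 + 2 * w / (1 + \<delta>) = (1 + \<delta> + 2 * w) / (1 + \<delta>)"
      using nz by (simp_all add: diff_divide_distrib add_divide_distrib)
    thus ?thesis using nz by simp
  qed
  also have "\<dots> = ((1 - w) / (1 + w))\<^sup>2"
    unfolding w(2)[symmetric] power_divide by (simp add: power2_sum power2_diff)
  finally have "landen (zolotarev_modulus \<delta>) = ((1 - sqrt \<delta>) / (1 + sqrt \<delta>))\<^sup>2"
    by (simp add: landen_def l(4) w_def)
  hence "C_star \<delta> = log_nome (landen (zolotarev_modulus \<delta>)) / 2"
    by (simp add: C_star_def log_nome_def Let_def)
  thus ?thesis by (simp add: log_nome_landen[OF l(1,2)])
qed

lemma C_star_pos:
  assumes \<delta>: "0 < \<delta>" "\<delta> < 1"
  shows "0 < C_star \<delta>"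
proof -
  note l = zolotarev_modulus_props(1,2)[OF \<delta>]
  show ?thesis
    unfolding C_star_eq_log_nome[OF \<delta>] log_nome_def
    by (intro divide_pos_pos mult_pos_pos elliptic_K_pos complementary_modulus l) simp_all
qed

text \<open>
  As \<open>\<delta>\<close> tends to \<open>0\<close>, the modulus tends to \<open>1\<close>: \<open>K'\<close> remains bounded and \<open>K\<close> grows like
  \<open>ln (1 / \<delta>)\<close>.
\<close>
lemma C_star_le:
  assumes \<delta>: "0 < \<delta>" "\<delta> \<le> 1 / 16"
  shows "C_star \<delta> \<le> 64 / ln (1 / \<delta>)"
proof -
  have \<delta>': "\<delta> < 1" using \<delta> by simp
  define l where "l = zolotarev_modulus \<delta>"
  note l = zolotarev_modulus_props[OF \<delta>(1) \<delta>', folded l_def]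
  define l' where "l' = sqrt (1 - l\<^sup>2)"
  note l' = complementary_modulus[OF l(1,2), folded l'_def]
  have lhalf: "1 / 2 \<le> l" using \<delta> by (simp add: l_def zolotarev_modulus_def field_simps)
  have L: "0 < ln (1 / \<delta>)" using \<delta> \<delta>' by simp
  have "sqrt (1 - l'\<^sup>2) = l" using l l' by simp
  hence "elliptic_K l' \<le> pi / 2 / l" using elliptic_K_le[OF l'(1,2)] by simp
  also have "\<dots> \<le> pi / 2 / (1 / 2)" using lhalf by (intro divide_left_mono) auto
  also have "\<dots> \<le> 4" using pi_less_4 by simp
  finally have K': "elliptic_K l' \<le> 4" .
  have "l' \<le> 2 * sqrt \<delta> / 1" unfolding l'_def l(4) using \<delta> by (intro divide_left_mono) auto
  hence "ln l' \<le> ln (2 * sqrt \<delta>)" using l' \<delta> by (intro ln_mono) auto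
  also have "\<dots> = ln 2 + ln \<delta> / 2" using \<delta> by (simp add: ln_mult ln_sqrt)
  also have "ln 2 \<le> - ln \<delta> / 4"
  proof -
    have "ln \<delta> \<le> ln (1 / 2 ^ 4)" using \<delta> by (intro ln_mono) auto
    also have "\<dots> = - 4 * ln 2" using ln_realpow[of "2::real" 4] by (simp add: ln_div)
    finally show ?thesis by simp
  qed
  finally have "ln (1 / \<delta>) / 8 \<le> ln (1 / l') / 2" using \<delta> l' by (simp add: ln_div)
  also have "\<dots> \<le> elliptic_K l" using elliptic_K_bounds(1)[OF l(1,2)] by (simp add: l'_def)
  finally have K: "ln (1 / \<delta>) / 8 \<le> elliptic_K l" .
  have "C_star \<delta> = pi / 2 * elliptic_K l' / elliptic_K l"
    by (simp add: C_star_eq_log_nome[OF \<delta>(1) \<delta>'] log_nome_def l_def l'_def)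
  also have "\<dots> \<le> 2 * 4 / (ln (1 / \<delta>) / 8)"
  proof (rule frac_le)
    show "pi / 2 * elliptic_K l' \<le> 2 * 4"
      using K' pi_less_4 elliptic_K_pos[OF l'(1,2)] by (intro mult_mono) auto
  qed (use K L in auto)
  finally show ?thesis by simp
qed

lemma C_star_bigo: "C_star \<in> O[at_right 0](\<lambda>d. 1 / ln (1 / d))"
proof (rule bigoI)
  have "eventually (\<lambda>d::real. d \<in> {0<..<1/16}) (at_right 0)"
    by (intro eventually_at_right_real) simp
  thus "eventually (\<lambda>d. norm (C_star d) \<le> 64 * norm (1 / ln (1 / d))) (at_right 0)"
  proof eventually_elim
    case (elim d)
    hence "0 < ln (1 / d)" by simp
    thus ?case using elim C_star_le[of d] C_star_pos[of d] by simp
  qed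
qed

lemma zolotarev_point_eq:
  fixes r j :: nat
  assumes \<delta>: "0 < \<delta>" "\<delta> < 1"
  defines "l \<equiv> zolotarev_modulus \<delta>"
  defines "z \<equiv> l * (jacobi_sn ((2 * (real r - real j) + 1) / (2 * real r) * elliptic_K l) l)\<^sup>2"
  shows "zolotarev_point \<delta> r j = (1 - z) / (1 + z)"
proof -
  note l = zolotarev_modulus_props[OF \<delta>, folded l_def]
  note \<kappa> = complementary_modulus(1,2)[OF \<delta>]
  have "(2 * (real r - real j) + 1) / (2 * real r) * elliptic_K (sqrt (1 - \<delta>\<^sup>2))
      = (1 + l) * ((2 * (real r - real j) + 1) / (2 * real r) * elliptic_K l)"
    by (simp add: elliptic_K_ascending_landen[OF l(1,2) \<kappa> l(3)])
  thus ?thesis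
    by (simp only: zolotarev_point_def Let_def ascending_landen(2)[OF l(1,2) \<kappa> l(3)] z_def)
qed

lemma zolotarev_point_pos:
  assumes \<delta>: "0 < \<delta>" "\<delta> < 1"
  shows "0 < zolotarev_point \<delta> r j"
  using dn_pos[OF complementary_modulus(1,2)[OF \<delta>]] by (simp add: zolotarev_point_def Let_def)

text \<open>
  The involution \<open>x \<mapsto> (1 - x) / (1 + x)\<close> turns \<open>(x - Z) / (x + Z)\<close> into a pseudo-hyperbolic difference
  of \<open>y = l sn\<^sup>2 u\<close> and \<open>z = l sn\<^sup>2 v\<close>, which the addition theorem splits into
  \<open>l * sn (v + u) * sn (v - u)\<close>. The arguments \<open>v + u\<close> and \<open>2 K - (v - u)\<close> for all Zolotarev points
  form a grid of \<open>2 r\<close> points.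
\<close>
lemma zolotarev_product_le:
  assumes \<delta>: "0 < \<delta>" "\<delta> < 1" and x: "\<delta> \<le> x" "x \<le> 1"
  shows "\<bar>\<Prod>j=1..r. (x - zolotarev_point \<delta> r j) / (x + zolotarev_point \<delta> r j)\<bar>
    \<le> 4 * exp (- C_star \<delta> * r)"
proof (cases "r = 0")
  case True
  thus ?thesis by simp
next
  case False
  define l where "l = zolotarev_modulus \<delta>"
  note l = zolotarev_modulus_props[OF \<delta>, folded l_def]
  define n where "n = 2 * r"
  have n: "0 < n" using False by (simp add: n_def)
  define K where "K = elliptic_K l"
  define y where "y = (1 - x) / (1 + x)"
  have xpos: "0 < 1 + x" using x \<delta> by simp
  have xy: "x = (1 - y) / (1 + y)"
  proof -
    have "1 - y = 2 * x / (1 + x)" "1 + y = 2 / (1 + x)" using xpos by (simp_all add: y_def field_simps)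
    thus ?thesis using xpos by simp
  qed
  have y: "0 \<le> y" "y \<le> l"
    unfolding y_def l_def zolotarev_modulus_def using x \<delta> by (auto intro!: frac_le)
  \<comment> \<open>the argument \<open>u\<close> with \<open>l sn\<^sup>2 u = y\<close>\<close>
  define u where "u = elliptic_F (arcsin (sqrt (y / l))) l"
  have "sqrt (y / l) \<le> 1" using y l by simp
  moreover have "- 1 \<le> sqrt (y / l)" by (rule order_trans[of _ 0]) (use y l in auto)
  ultimately have "sin (arcsin (sqrt (y / l))) = sqrt (y / l)" by simp
  hence "jacobi_sn u l = sqrt (y / l)" using l(1,2) by (simp add: jacobi_sn_def u_def)
  hence yu: "y = l * (jacobi_sn u l)\<^sup>2" using y l by simp
  define v where "v i = K / n + 2 * K * real i / n" for i
  have fac: "\<bar>(x - zolotarev_point \<delta> r j) / (x + zolotarev_point \<delta> r j)\<bar>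
      = l * \<bar>jacobi_sn (v (r - j) + u) l * jacobi_sn (v (r - j) - u) l\<bar>" if j: "j \<in> {1..r}" for j
  proof -
    have vj: "v (r - j) = (2 * (real r - real j) + 1) / (2 * real r) * K"
      using j by (simp add: v_def n_def of_nat_diff field_simps)
    define z where "z = l * (jacobi_sn (v (r - j)) l)\<^sup>2"
    have z: "0 \<le> z" using l by (simp add: z_def)
    have Z: "zolotarev_point \<delta> r j = (1 - z) / (1 + z)"
      using zolotarev_point_eq[OF \<delta>, of r j] by (simp add: z_def vj l_def K_def)
    have yz: "1 - y * z = 1 - l\<^sup>2 * (jacobi_sn (v (r - j)) l)\<^sup>2 * (jacobi_sn u l)\<^sup>2"
      by (simp add: yu z_def power2_eq_square)
    have pos: "0 < 1 - y * z" unfolding yz by (rule sn_denom_pos[OF l(1,2)])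
    have nz: "1 + y \<noteq> 0" "1 + z \<noteq> 0" using y z by auto
    have "x - zolotarev_point \<delta> r j = 2 * (z - y) / ((1 + y) * (1 + z))"
      unfolding Z xy using nz by (simp add: divide_simps) (simp add: algebra_simps)
    moreover have "x + zolotarev_point \<delta> r j = 2 * (1 - y * z) / ((1 + y) * (1 + z))"
      unfolding Z xy using nz by (simp add: divide_simps) (simp add: algebra_simps)
    moreover have "(2 * a / D) / (2 * b / D) = a / b" if "D \<noteq> 0" for a b D :: real
      using that by simp
    ultimately have "(x - zolotarev_point \<delta> r j) / (x + zolotarev_point \<delta> r j) = (z - y) / (1 - y * z)"
      using nz by (simp only: mult_eq_0_iff simp_thms)
    also have "\<dots> = l * (jacobi_sn (v (r - j) + u) l * jacobi_sn (v (r - j) - u) l)"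
      unfolding sn_add_mult_sn_diff[OF l(1,2)] yz by (simp add: z_def yu right_diff_distrib)
    finally show ?thesis using l by (simp add: abs_mult)
  qed
  define g where "g i = sqrt l * \<bar>jacobi_sn (u + K / n + 2 * K * real i / n) l\<bar>" for i
  have g: "g i = sqrt l * \<bar>jacobi_sn (v i + u) l\<bar>" for i by (simp add: g_def v_def add_ac)
  have g': "g (r + (r - Suc i)) = sqrt l * \<bar>jacobi_sn (v i - u) l\<bar>" if "i < r" for i
  proof -
    have i: "real (r + (r - Suc i)) = real n - 1 - real i" using that by (simp add: n_def)
    have eq: "2 * K - (v i - u) = u + K / n + 2 * K * real (r + (r - Suc i)) / n"
      unfolding i v_def using n by (simp add: field_simps)
    show ?thesis
      using abs_sn_2K_diff[OF l(1,2), of "v i - u", folded K_def, unfolded eq] by (simp only: g_def)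
  qed
  have "\<bar>\<Prod>j=1..r. (x - zolotarev_point \<delta> r j) / (x + zolotarev_point \<delta> r j)\<bar>
      = (\<Prod>j=1..r. l * \<bar>jacobi_sn (v (r - j) + u) l * jacobi_sn (v (r - j) - u) l\<bar>)"
    by (simp only: abs_prod fac cong: prod.cong)
  also have "\<dots> = (\<Prod>i<r. l * \<bar>jacobi_sn (v i + u) l * jacobi_sn (v i - u) l\<bar>)"
    by (rule prod.reindex_bij_witness[where i = "\<lambda>i. r - i" and j = "\<lambda>j. r - j"]) auto
  also have "\<dots> = (\<Prod>i<r. g i * g (r + (r - Suc i)))"
  proof (intro prod.cong refl)
    fix i assume "i \<in> {..<r}"
    hence i: "i < r" by simp
    have "g i * g (r + (r - Suc i)) = (sqrt l * sqrt l) * \<bar>jacobi_sn (v i + u) l * jacobi_sn (v i - u) l\<bar>"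
      unfolding g[of i] g'[OF i] by (simp only: abs_mult mult_ac)
    thus "l * \<bar>jacobi_sn (v i + u) l * jacobi_sn (v i - u) l\<bar> = g i * g (r + (r - Suc i))"
      using l by simp
  qed
  also have "\<dots> = (\<Prod>i<r. g i) * (\<Prod>i<r. g (r + i))"
    unfolding prod.distrib prod.nat_diff_reindex[where g = "\<lambda>i. g (r + i)"] ..
  also have "\<dots> = (\<Prod>i<n. g i)" unfolding n_def mult_2 prod_lessThan_add ..
  also have "\<dots> = sn_grid l n (u + K / n)" by (simp add: sn_grid_def g_def K_def)
  also have "\<dots> \<le> 4 * exp (- (n / 2 * log_nome l))" by (rule sn_grid_le[OF n l(1,2)])
  also have "\<dots> = 4 * exp (- C_star \<delta> * r)"
    by (simp add: C_star_eq_log_nome[OF \<delta>] l_def n_def mult.commute)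
  finally show ?thesis .
qed

section \<open>Rational interpolation of resolvents\<close>

text \<open>The Blaschke factor of the right half-plane with zero \<open>1 / \<tau>\<close>.\<close>
definition blaschke :: "real \<Rightarrow> real \<Rightarrow> real"
  where "blaschke \<tau> x = (\<tau> * x - 1) / (\<tau> * x + 1)"

lemma abs_blaschke_le_1:
  assumes "0 < \<tau>" "0 \<le> x"
  shows "\<bar>blaschke \<tau> x\<bar> \<le> 1"
proof -
  have "0 \<le> \<tau> * x" using assms by simp
  hence "\<bar>\<tau> * x - 1\<bar> \<le> \<tau> * x + 1" "0 < \<tau> * x + 1" by linarith+
  thus ?thesis by (simp add: blaschke_def abs_divide)
qed

text \<open>
  As \<open>W (- x) = 1 / W x\<close>, the numerator vanishes at \<open>y = - x\<close>; what remains is a proper fraction with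
  the simple poles \<open>- 1 / \<tau>\<close>. The induction over the poles computes its coefficients.
\<close>
lemma partial_fractions:
  assumes "finite T" "\<forall>\<tau>\<in>T. 0 < \<tau>" "0 < x"
  shows "\<exists>c. \<forall>y>0. (1 - (\<Prod>\<tau>\<in>T. blaschke \<tau> y) * (\<Prod>\<tau>\<in>T. blaschke \<tau> x)) / (x + y)
    = (\<Sum>\<tau>\<in>T. c \<tau> / (1 + \<tau> * y))"
  using assms(1,2)
proof (induction T rule: finite_induct)
  case empty
  thus ?case by simp
next
  case (insert \<tau> T)
  then obtain c where c: "\<And>y. 0 < y \<Longrightarrow>
      (1 - (\<Prod>\<sigma>\<in>T. blaschke \<sigma> y) * (\<Prod>\<sigma>\<in>T. blaschke \<sigma> x)) / (x + y) = (\<Sum>\<sigma>\<in>T. c \<sigma> / (1 + \<sigma> * y))"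
    by auto
  have \<tau>: "0 < \<tau>" and T: "\<And>\<sigma>. \<sigma> \<in> T \<Longrightarrow> 0 < \<sigma> \<and> \<sigma> \<noteq> \<tau>" using insert by auto
  define m where "m = blaschke \<tau> x"
  \<comment> \<open>from the partial fractions of \<open>(\<tau> y - 1) / ((1 + \<tau> y) (1 + \<sigma> y))\<close>\<close>
  define c' where "c' \<sigma> = (if \<sigma> = \<tau>
      then 2 * \<tau> / (\<tau> * x + 1) - m * (\<Sum>\<sigma>\<in>T. c \<sigma> * (2 * \<tau> / (\<tau> - \<sigma>)))
      else m * c \<sigma> * ((\<tau> + \<sigma>) / (\<tau> - \<sigma>)))" for \<sigma>
  have "(1 - (\<Prod>\<sigma>\<in>insert \<tau> T. blaschke \<sigma> y) * (\<Prod>\<sigma>\<in>insert \<tau> T. blaschke \<sigma> x)) / (x + y)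
      = (\<Sum>\<sigma>\<in>insert \<tau> T. c' \<sigma> / (1 + \<sigma> * y))" if y: "0 < y" for y
  proof -
    define P Q where PQ: "P = (\<Prod>\<sigma>\<in>T. blaschke \<sigma> y)" "Q = (\<Prod>\<sigma>\<in>T. blaschke \<sigma> x)"
    define n where "n = blaschke \<tau> y"
    have nz: "\<tau> * y + 1 \<noteq> 0" "\<tau> * x + 1 \<noteq> 0" "x + y \<noteq> 0"
      using \<tau> y assms(3) by (auto simp: add_nonneg_eq_0_iff)
    have nm: "(1 - n * m) / (x + y) = 2 * \<tau> / (\<tau> * x + 1) / (1 + \<tau> * y)"
    proof -
      have "1 - n * m = 2 * \<tau> * (x + y) / ((\<tau> * y + 1) * (\<tau> * x + 1))"
        unfolding n_def m_def blaschke_def using nz by (simp add: divide_simps) (simp add: algebra_simps)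
      thus ?thesis using nz by (simp add: add.commute mult.commute)
    qed
    have split: "n / (1 + \<sigma> * y) = (\<tau> + \<sigma>) / (\<tau> - \<sigma>) / (1 + \<sigma> * y) - 2 * \<tau> / (\<tau> - \<sigma>) / (1 + \<tau> * y)"
      if "\<sigma> \<in> T" for \<sigma>
    proof -
      have s: "1 + \<sigma> * y \<noteq> 0" "1 + \<tau> * y \<noteq> 0" "\<tau> - \<sigma> \<noteq> 0"
        using T[OF that] \<tau> y by (auto simp: add_nonneg_eq_0_iff)
      have "(\<tau> + \<sigma>) * (1 + \<tau> * y) - 2 * \<tau> * (1 + \<sigma> * y) = (\<tau> - \<sigma>) * (\<tau> * y - 1)"
        by (simp add: algebra_simps)
      hence "(\<tau> + \<sigma>) / (\<tau> - \<sigma>) / (1 + \<sigma> * y) - 2 * \<tau> / (\<tau> - \<sigma>) / (1 + \<tau> * y)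
          = (\<tau> - \<sigma>) * (\<tau> * y - 1) / ((\<tau> - \<sigma>) * (1 + \<sigma> * y) * (1 + \<tau> * y))"
        using s by (simp add: divide_simps)
      thus ?thesis using s by (simp add: n_def blaschke_def add.commute)
    qed
    have "(1 - (\<Prod>\<sigma>\<in>insert \<tau> T. blaschke \<sigma> y) * (\<Prod>\<sigma>\<in>insert \<tau> T. blaschke \<sigma> x)) / (x + y)
        = (1 - (n * P) * (m * Q)) / (x + y)"
      using insert by (simp add: PQ n_def m_def)
    also have "1 - (n * P) * (m * Q) = (1 - n * m) + m * n * (1 - P * Q)"
      by (simp add: algebra_simps)
    also have "\<dots> / (x + y) = (1 - n * m) / (x + y) + m * n * ((1 - P * Q) / (x + y))"
      by (simp only: add_divide_distrib times_divide_eq_right)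
    also have "(1 - P * Q) / (x + y) = (\<Sum>\<sigma>\<in>T. c \<sigma> / (1 + \<sigma> * y))" using c[OF y] by (simp add: PQ)
    also have "m * n * (\<Sum>\<sigma>\<in>T. c \<sigma> / (1 + \<sigma> * y)) = (\<Sum>\<sigma>\<in>T. m * c \<sigma> * (n / (1 + \<sigma> * y)))"
      by (simp add: sum_distrib_left mult_ac)
    also have "\<dots> = (\<Sum>\<sigma>\<in>T. m * c \<sigma> * ((\<tau> + \<sigma>) / (\<tau> - \<sigma>)) / (1 + \<sigma> * y)
        - m * (c \<sigma> * (2 * \<tau> / (\<tau> - \<sigma>))) / (1 + \<tau> * y))"
      by (intro sum.cong refl) (simp add: split right_diff_distrib)
    also have "\<dots> = (\<Sum>\<sigma>\<in>T. c' \<sigma> / (1 + \<sigma> * y))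
        - m * (\<Sum>\<sigma>\<in>T. c \<sigma> * (2 * \<tau> / (\<tau> - \<sigma>))) / (1 + \<tau> * y)"
    proof -
      have "(\<Sum>\<sigma>\<in>T. m * c \<sigma> * ((\<tau> + \<sigma>) / (\<tau> - \<sigma>)) / (1 + \<sigma> * y)) = (\<Sum>\<sigma>\<in>T. c' \<sigma> / (1 + \<sigma> * y))"
        by (intro sum.cong refl) (use T in \<open>auto simp: c'_def\<close>)
      thus ?thesis by (simp only: sum_subtractf sum_distrib_left sum_divide_distrib)
    qed
    also have "(1 - n * m) / (x + y) + \<dots> = c' \<tau> / (1 + \<tau> * y) + (\<Sum>\<sigma>\<in>T. c' \<sigma> / (1 + \<sigma> * y))"
      unfolding nm by (simp add: c'_def diff_divide_distrib)
    also have "\<dots> = (\<Sum>\<sigma>\<in>insert \<tau> T. c' \<sigma> / (1 + \<sigma> * y))" using insert by simp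
    finally show ?thesis .
  qed
  thus ?case by blast
qed

section \<open>Fractional powers as superpositions of resolvents\<close>
definition stieltjes_kernel :: "real \<Rightarrow> real \<Rightarrow> real \<Rightarrow> real"
  where "stieltjes_kernel s p x = indicator {0<..} x * (x powr (s - 1) * (p / (x + p)))"

lemma stieltjes_kernel_borel [measurable]: "stieltjes_kernel s p \<in> borel_measurable borel"
  unfolding stieltjes_kernel_def[abs_def] by measurable

lemma integrable_stieltjes_kernel_1:
  assumes s: "0 < s" "s < 1"
  shows "integrable lborel (stieltjes_kernel s 1)"
proof (rule Bochner_Integration.integrable_bound)
  have "set_integrable lebesgue {0<..1} (\<lambda>x::real. x powr (s - 1))"
    using s by (intro nonnegative_absolutely_integrable_1 integrable_on_powr_from_0') auto
  hence 1: "integrable lborel (\<lambda>x::real. indicator {0<..1} x * x powr (s - 1))"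
    unfolding set_integrable_def by (subst (asm) integrable_completion) auto
  have "(\<lambda>x::real. x powr (s - 2)) integrable_on {1..}"
    using has_integral_powr_to_inf[of "s - 2" 1] s by (auto simp: integrable_on_def)
  hence "set_integrable lebesgue {1..} (\<lambda>x::real. x powr (s - 2))"
    by (intro nonnegative_absolutely_integrable_1) auto
  hence 2: "integrable lborel (\<lambda>x::real. indicator {1..} x * x powr (s - 2))"
    unfolding set_integrable_def by (subst (asm) integrable_completion) auto
  show "integrable lborel (\<lambda>x::real. indicator {0<..1} x * x powr (s - 1) + indicator {1..} x * x powr (s - 2))"
    using 1 2 by simp
  show "AE x in lborel. norm (stieltjes_kernel s 1 x)
      \<le> norm (indicator {0<..1} x * x powr (s - 1) + indicator {1..} x * x powr (s - 2))"
  proof (rule AE_I2)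
    fix x :: real
    consider "x \<le> 0" | "0 < x" "x \<le> 1" | "1 < x" by linarith
    thus "norm (stieltjes_kernel s 1 x)
      \<le> norm (indicator {0<..1} x * x powr (s - 1) + indicator {1..} x * x powr (s - 2))"
    proof cases
      case 1
      thus ?thesis by (simp add: stieltjes_kernel_def)
    next
      case 2
      hence "x powr (s - 1) / (x + 1) \<le> x powr (s - 1) / 1" by (intro divide_left_mono) auto
      thus ?thesis using 2 by (simp add: stieltjes_kernel_def indicator_def)
    next
      case 3
      hence "x powr (s - 1) / (x + 1) \<le> x powr (s - 1) / x" by (intro divide_left_mono) auto
      also have "\<dots> = x powr (s - 2)" using 3 powr_diff[of x "s - 1" 1] by simp
      finally show ?thesis using 3 by (simp add: stieltjes_kernel_def indicator_def)
    qed
  qed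
qed auto

lemma stieltjes_kernel_scale:
  assumes "0 < p"
  shows "stieltjes_kernel s p (0 + p * x) = p powr (s - 1) * stieltjes_kernel s 1 x"
proof (cases "0 < x")
  case True
  have "p / (p * x + p) = (p * 1) / (p * (x + 1))" by (simp add: distrib_left)
  hence "p / (p * x + p) = 1 / (x + 1)" using assms by simp
  thus ?thesis using assms True by (simp add: stieltjes_kernel_def powr_mult)
next
  case False
  thus ?thesis using assms by (simp add: stieltjes_kernel_def zero_less_mult_iff)
qed

lemma integrable_stieltjes_kernel:
  assumes s: "0 < s" "s < 1" and p: "0 < p"
  shows "integrable lborel (stieltjes_kernel s p)"
proof -
  have "integrable lborel (\<lambda>x. stieltjes_kernel s p (0 + p * x))"
    unfolding stieltjes_kernel_scale[OF p]
    using integrable_stieltjes_kernel_1[OF s] by simp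
  thus ?thesis using p by (subst (asm) lborel_integrable_real_affine_iff) auto
qed

text \<open>The substitution \<open>x = p y\<close>; the integral for \<open>p = 1\<close> is the constant of proportionality.\<close>
lemma integral_stieltjes_kernel:
  assumes p: "0 < p"
  shows "(\<integral>x. stieltjes_kernel s p x \<partial>lborel) = p powr s * (\<integral>x. stieltjes_kernel s 1 x \<partial>lborel)"
proof -
  have "(\<integral>x. stieltjes_kernel s p x \<partial>lborel) = p * (\<integral>x. stieltjes_kernel s p (0 + p * x) \<partial>lborel)"
    using lborel_integral_real_affine[of p "stieltjes_kernel s p" 0] p by simp
  also have "\<dots> = p * p powr (s - 1) * (\<integral>x. stieltjes_kernel s 1 x \<partial>lborel)"
    unfolding stieltjes_kernel_scale[OF p] by simp
  also have "p * p powr (s - 1) = p powr s"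
    using p powr_add[of p 1 "s - 1"] by simp
  finally show ?thesis .
qed

lemma integral_stieltjes_kernel_pos:
  assumes s: "0 < s" "s < 1"
  shows "0 < (\<integral>x. stieltjes_kernel s 1 x \<partial>lborel)"
proof -
  have "(\<integral>x. indicator {1..2::real} x * (1 / 6) \<partial>lborel) \<le> (\<integral>x. stieltjes_kernel s 1 x \<partial>lborel)"
  proof (rule integral_mono)
    show "integrable lborel (\<lambda>x::real. indicator {1..2} x * (1 / 6 :: real))" by simp
    fix x :: real
    show "indicator {1..2} x * (1 / 6) \<le> stieltjes_kernel s 1 x"
    proof (cases "x \<in> {1..2}")
      case True
      hence x: "1 \<le> x" "x \<le> 2" by auto
      have "1 / 2 \<le> x powr (- 1)" using x by (simp add: powr_minus_divide)
      also have "\<dots> \<le> x powr (s - 1)" using x s by (intro powr_mono) auto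
      finally have "1 / 2 * (1 / 3) \<le> x powr (s - 1) * (1 / (x + 1))"
        using x by (intro mult_mono) (auto simp: field_simps)
      thus ?thesis using True by (simp add: stieltjes_kernel_def)
    next
      case False
      thus ?thesis by (cases "0 < x") (auto simp: stieltjes_kernel_def)
    qed
  qed (rule integrable_stieltjes_kernel_1[OF s])
  thus ?thesis by simp
qed

text \<open>
  Integrating the hypothesis against \<open>x\<^sup>s\<^sup>-\<^sup>1\<close> turns each fraction \<open>p / (x + p)\<close>, including the one in the
  bound, into the power \<open>p\<^sup>s\<close>.
\<close>
lemma powr_combination_bound:
  fixes a p :: "'i \<Rightarrow> real"
  assumes s: "0 < s" "s < 1" and p: "\<And>i. i \<in> A \<Longrightarrow> 0 < p i" and b: "0 < b"
    and bound: "\<And>x. 0 < x \<Longrightarrow> \<bar>\<Sum>i\<in>A. a i * (p i / (x + p i))\<bar> \<le> M * (b / (x + b))"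
  shows "\<bar>\<Sum>i\<in>A. a i * p i powr s\<bar> \<le> M * b powr s"
proof -
  define I where "I = (\<integral>x. stieltjes_kernel s 1 x \<partial>lborel)"
  have I: "0 < I" unfolding I_def by (rule integral_stieltjes_kernel_pos[OF s])
  have int: "integrable lborel (\<lambda>x. a i * stieltjes_kernel s (p i) x)" if "i \<in> A" for i
    using integrable_stieltjes_kernel[OF s p[OF that]] by simp
  have "(\<Sum>i\<in>A. a i * p i powr s) * I = (\<Sum>i\<in>A. a i * (p i powr s * I))"
    by (simp add: sum_distrib_right mult.assoc)
  also have "\<dots> = (\<Sum>i\<in>A. \<integral>x. a i * stieltjes_kernel s (p i) x \<partial>lborel)"
    by (intro sum.cong refl) (simp add: integral_stieltjes_kernel[OF p] I_def)
  also have "\<dots> = (\<integral>x. (\<Sum>i\<in>A. a i * stieltjes_kernel s (p i) x) \<partial>lborel)"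
    by (rule Bochner_Integration.integral_sum[symmetric]) (rule int)
  finally have eq: "(\<Sum>i\<in>A. a i * p i powr s) * I = (\<integral>x. (\<Sum>i\<in>A. a i * stieltjes_kernel s (p i) x) \<partial>lborel)" .
  have "\<bar>\<Sum>i\<in>A. a i * p i powr s\<bar> * I = \<bar>\<integral>x. (\<Sum>i\<in>A. a i * stieltjes_kernel s (p i) x) \<partial>lborel\<bar>"
    unfolding eq[symmetric] using I by (simp add: abs_mult)
  also have "\<dots> \<le> (\<integral>x. \<bar>\<Sum>i\<in>A. a i * stieltjes_kernel s (p i) x\<bar> \<partial>lborel)"
    using integral_norm_bound[of lborel "\<lambda>x. \<Sum>i\<in>A. a i * stieltjes_kernel s (p i) x"] by simp
  also have "\<dots> \<le> (\<integral>x. M * stieltjes_kernel s b x \<partial>lborel)"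
  proof (rule integral_mono)
    show "integrable lborel (\<lambda>x. \<bar>\<Sum>i\<in>A. a i * stieltjes_kernel s (p i) x\<bar>)"
      by (intro integrable_abs Bochner_Integration.integrable_sum int)
    show "integrable lborel (\<lambda>x. M * stieltjes_kernel s b x)"
      using integrable_stieltjes_kernel[OF s b] by simp
    fix x :: real
    show "\<bar>\<Sum>i\<in>A. a i * stieltjes_kernel s (p i) x\<bar> \<le> M * stieltjes_kernel s b x"
    proof (cases "0 < x")
      case True
      have "(\<Sum>i\<in>A. a i * stieltjes_kernel s (p i) x) = x powr (s - 1) * (\<Sum>i\<in>A. a i * (p i / (x + p i)))"
        using True by (simp add: stieltjes_kernel_def sum_distrib_left mult_ac)
      hence "\<bar>\<Sum>i\<in>A. a i * stieltjes_kernel s (p i) x\<bar> = x powr (s - 1) * \<bar>\<Sum>i\<in>A. a i * (p i / (x + p i))\<bar>"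
        by (simp add: abs_mult)
      also have "\<dots> \<le> x powr (s - 1) * (M * (b / (x + b)))"
        by (intro mult_left_mono bound True) simp
      also have "\<dots> = M * stieltjes_kernel s b x" using True by (simp add: stieltjes_kernel_def mult_ac)
      finally show ?thesis .
    qed (simp add: stieltjes_kernel_def)
  qed
  also have "\<dots> = M * b powr s * I" by (simp add: integral_stieltjes_kernel[OF b] I_def)
  finally show ?thesis using I by simp
qed

section \<open>Spectral calculus on the discrete and the reduced space\<close>
definition spectral_op ::
  "('b::real_inner \<Rightarrow> 'a::real_inner) \<Rightarrow> nat \<Rightarrow> (nat \<Rightarrow> 'b) \<Rightarrow> (nat \<Rightarrow> real) \<Rightarrow> (real \<Rightarrow> real) \<Rightarrow> 'b \<Rightarrow> 'b"
  where "spectral_op J n \<phi> lam g v = (\<Sum>k=1..n. (g ((lam k)\<^sup>2) * ip0 J v (\<phi> k)) *\<^sub>R \<phi> k)"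

locale discrete_eigensystem =
  fixes J :: "'b::real_inner \<Rightarrow> 'a::real_inner" and V :: "'b set"
    and \<phi> :: "nat \<Rightarrow> 'b" and lam :: "nat \<Rightarrow> real"
  assumes linear_J: "linear J" and inj_J: "inj J"
    and subspace_V: "subspace V" and finite_dim_V: "\<exists>B. finite B \<and> span B = V"
    and eigen: "eigenpairs_on J V \<phi> lam"
begin

abbreviation "ip \<equiv> ip0 J"
abbreviation "n \<equiv> dim V"
abbreviation "calc \<equiv> spectral_op J n \<phi> lam"

lemma ip_commute: "ip v w = ip w v" by (simp add: ip0_def inner_commute)
lemma ip_diff: "ip (v - v') w = ip v w - ip v' w"
  by (simp add: ip0_def linear_diff[OF linear_J] inner_diff_left)
lemma ip_scale: "ip (c *\<^sub>R v) w = c * ip v w"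
  by (simp add: ip0_def linear_scale[OF linear_J])
lemma ip_sum: "ip (\<Sum>i\<in>A. f i) w = (\<Sum>i\<in>A. ip (f i) w)"
  by (simp add: ip0_def linear_sum[OF linear_J] inner_sum_left)

lemma eigen_mem: "k \<in> {1..n} \<Longrightarrow> \<phi> k \<in> V"
  and lam_pos: "k \<in> {1..n} \<Longrightarrow> 0 < lam k"
  and orthonormal: "k \<in> {1..n} \<Longrightarrow> l \<in> {1..n} \<Longrightarrow> ip (\<phi> k) (\<phi> l) = (if k = l then 1 else 0)"
  and eigen_eq: "k \<in> {1..n} \<Longrightarrow> w \<in> V \<Longrightarrow> \<phi> k \<bullet> w = (lam k)\<^sup>2 * ip (\<phi> k) w"
  using eigen by (auto simp: eigenpairs_on_def)

lemma ip_combination: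
  assumes l: "l \<in> {1..n}"
  shows "ip (\<Sum>k=1..n. c k *\<^sub>R \<phi> k) (\<phi> l) = c l"
proof -
  have "ip (\<Sum>k=1..n. c k *\<^sub>R \<phi> k) (\<phi> l) = (\<Sum>k=1..n. if k = l then c k else 0)"
    unfolding ip_sum by (intro sum.cong refl) (use l in \<open>auto simp: ip_scale orthonormal\<close>)
  also have "\<dots> = c l" using l by simp
  finally show ?thesis .
qed

lemma combination_mem: "(\<Sum>k=1..n. c k *\<^sub>R \<phi> k) \<in> V"
  by (intro subspace_sum subspace_scale subspace_V eigen_mem)

lemma calc_mem: "calc g v \<in> V"
  unfolding spectral_op_def by (rule combination_mem)

text \<open>
  A nonzero remainder of the expansion would be, together with the eigenvectors, an orthogonal family
  of \<open>dim V + 1\<close> vectors. The orthogonality holds for the images under \<open>J\<close>, so the dimensions are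
  counted there.
\<close>
lemma expansion:
  assumes v: "v \<in> V"
  shows "v = (\<Sum>k=1..n. ip v (\<phi> k) *\<^sub>R \<phi> k)"
proof (rule ccontr)
  define w where "w = v - (\<Sum>k=1..n. ip v (\<phi> k) *\<^sub>R \<phi> k)"
  assume "v \<noteq> (\<Sum>k=1..n. ip v (\<phi> k) *\<^sub>R \<phi> k)"
  hence "w \<noteq> 0" by (simp add: w_def)
  hence Jw: "J w \<noteq> 0" using inj_J linear_J by (metis injD linear_0)
  have wV: "w \<in> V" unfolding w_def by (intro subspace_diff subspace_V v combination_mem)
  have worth: "J w \<bullet> J (\<phi> l) = 0" if "l \<in> {1..n}" for l
    using ip_combination[OF that, of "\<lambda>k. ip v (\<phi> k)"] by (simp add: w_def ip_diff flip: ip0_def)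
  have worth': "J (\<phi> l) \<bullet> J w = 0" if "l \<in> {1..n}" for l
    using worth[OF that] by (simp add: inner_commute)
  define S where "S = insert (J w) ((\<lambda>k. J (\<phi> k)) ` {1..n})"
  have on: "J (\<phi> k) \<bullet> J (\<phi> l) = (if k = l then 1 else 0)" if "k \<in> {1..n}" "l \<in> {1..n}" for k l
    using orthonormal[OF that] by (simp add: ip0_def)
  have inj: "inj_on (\<lambda>k. J (\<phi> k)) {1..n}"
  proof (rule inj_onI)
    fix k l assume kl: "k \<in> {1..n}" "l \<in> {1..n}" "J (\<phi> k) = J (\<phi> l)"
    thus "k = l" using on[OF kl(1,2)] on[OF kl(2,2)] by (auto split: if_splits)
  qed
  have nin: "J w \<notin> (\<lambda>k. J (\<phi> k)) ` {1..n}"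
  proof
    assume "J w \<in> (\<lambda>k. J (\<phi> k)) ` {1..n}"
    then obtain k where k: "k \<in> {1..n}" "J w = J (\<phi> k)" by blast
    thus False using worth[OF k(1)] on[OF k(1) k(1)] by simp
  qed
  have card: "card S = Suc n" unfolding S_def using nin inj by (simp add: card_image)
  have "independent S"
  proof (rule pairwise_orthogonal_independent)
    have "J (\<phi> k) \<noteq> 0" if "k \<in> {1..n}" for k
      using on[OF that that] by auto
    thus "0 \<notin> S" using Jw by (auto simp: S_def)
    show "pairwise orthogonal S"
      unfolding pairwise_def S_def orthogonal_def using worth worth' on by auto
  qed
  moreover obtain B where B: "B \<subseteq> V" "independent B" "V \<subseteq> span B" "card B = n"
    using basis_exists by blast
  have finB: "finite B"
  proof -
    obtain B' where "finite B'" "span B' = V" using finite_dim_V by blast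
    thus ?thesis using B independent_span_bound[of B' B] by blast
  qed
  moreover have "S \<subseteq> span (J ` B)"
  proof -
    have "span (J ` B) = J ` span B" using linear_J by (rule linear_span_image)
    moreover have "S \<subseteq> J ` V" using wV eigen_mem by (auto simp: S_def)
    ultimately show ?thesis using B(3) by blast
  qed
  ultimately have "card S \<le> card (J ` B)" using independent_span_bound[of "J ` B" S] by blast
  also have "\<dots> \<le> n" using card_image_le[OF finB, of J] B(4) by simp
  finally show False using card by simp
qed

lemma ip_calc: "l \<in> {1..n} \<Longrightarrow> ip (calc g v) (\<phi> l) = g ((lam l)\<^sup>2) * ip v (\<phi> l)"
  unfolding spectral_op_def by (rule ip_combination)

lemma parseval:
  assumes v: "v \<in> V"
  shows "ip v w = (\<Sum>k=1..n. ip v (\<phi> k) * ip w (\<phi> k))"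
proof -
  have "ip v w = ip (\<Sum>k=1..n. ip v (\<phi> k) *\<^sub>R \<phi> k) w" using expansion[OF v] by simp
  thus ?thesis unfolding ip_sum ip_scale by (simp add: ip_commute[of w])
qed

lemma inner_eq:
  assumes v: "v \<in> V" and w: "w \<in> V"
  shows "v \<bullet> w = (\<Sum>k=1..n. (lam k)\<^sup>2 * ip v (\<phi> k) * ip w (\<phi> k))"
proof -
  have "v \<bullet> w = (\<Sum>k=1..n. ip v (\<phi> k) *\<^sub>R \<phi> k) \<bullet> w" using expansion[OF v] by simp
  also have "\<dots> = (\<Sum>k=1..n. ip v (\<phi> k) * ((lam k)\<^sup>2 * ip (\<phi> k) w))"
    unfolding inner_sum_left inner_scaleR_left by (intro sum.cong refl) (simp add: eigen_eq w)
  finally show ?thesis by (simp add: mult_ac ip_commute[of w])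
qed

lemma norm0_power2:
  assumes v: "v \<in> V"
  shows "(norm0 J v)\<^sup>2 = (\<Sum>k=1..n. (ip v (\<phi> k))\<^sup>2)"
proof -
  have "(norm0 J v)\<^sup>2 = ip v v" by (simp add: norm0_def ip0_def power2_norm_eq_inner)
  thus ?thesis by (simp add: parseval[OF v, of v] power2_eq_square)
qed

lemma norm0_calc_le:
  assumes v: "v \<in> V" and g: "\<And>k. k \<in> {1..n} \<Longrightarrow> \<bar>g ((lam k)\<^sup>2)\<bar> \<le> M" and M: "0 \<le> M"
  shows "norm0 J (calc g v) \<le> M * norm0 J v"
proof (rule power2_le_imp_le)
  have "(norm0 J (calc g v))\<^sup>2 = (\<Sum>k=1..n. (g ((lam k)\<^sup>2))\<^sup>2 * (ip v (\<phi> k))\<^sup>2)"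
    unfolding norm0_power2[OF calc_mem] by (intro sum.cong refl) (simp add: ip_calc power_mult_distrib)
  also have "\<dots> \<le> (\<Sum>k=1..n. M\<^sup>2 * (ip v (\<phi> k))\<^sup>2)"
    using g M by (intro sum_mono mult_right_mono) (auto simp: abs_le_square_iff[symmetric])
  also have "\<dots> = (M * norm0 J v)\<^sup>2"
    by (simp add: power_mult_distrib norm0_power2[OF v] sum_distrib_left)
  finally show "(norm0 J (calc g v))\<^sup>2 \<le> (M * norm0 J v)\<^sup>2" .
qed (simp add: M norm0_def)

lemma eqI:
  assumes "v \<in> V" "w \<in> V" "\<And>k. k \<in> {1..n} \<Longrightarrow> ip v (\<phi> k) = ip w (\<phi> k)"
  shows "v = w"
proof -
  have "v = (\<Sum>k=1..n. ip v (\<phi> k) *\<^sub>R \<phi> k)" by (rule expansion[OF assms(1)])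
  also have "\<dots> = (\<Sum>k=1..n. ip w (\<phi> k) *\<^sub>R \<phi> k)" by (intro sum.cong refl) (simp add: assms(3))
  also have "\<dots> = w" by (rule expansion[OF assms(2), symmetric])
  finally show ?thesis .
qed

text \<open>
  The membership of a Galerkin solution in \<open>V\<close> is a hypothesis here, so that the lemma applies to the
  reduced space as well: a snapshot that lies in the reduced space also solves the reduced problem.
\<close>
lemma galerkin_solution:
  assumes v: "v \<in> V" and "\<And>w. w \<in> V \<Longrightarrow> ip v w + t\<^sup>2 * (v \<bullet> w) = ip u w"
  shows "v = calc (\<lambda>x. 1 / (1 + t\<^sup>2 * x)) u"
proof (rule eqI[OF v calc_mem])
  fix k assume k: "k \<in> {1..n}"
  have "v \<bullet> \<phi> k = (lam k)\<^sup>2 * ip v (\<phi> k)"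
    using eigen_eq[OF k v] by (simp add: inner_commute ip_commute)
  with assms(2)[OF eigen_mem[OF k]] have "(1 + t\<^sup>2 * (lam k)\<^sup>2) * ip v (\<phi> k) = ip u (\<phi> k)"
    by (simp add: algebra_simps)
  moreover have "0 < 1 + t\<^sup>2 * (lam k)\<^sup>2" by (intro add_pos_nonneg) auto
  ultimately show "ip v (\<phi> k) = ip (calc (\<lambda>x. 1 / (1 + t\<^sup>2 * x)) u) (\<phi> k)"
    unfolding ip_calc[OF k] by (simp add: field_simps)
qed

lemma snapshot_spec:
  shows "snapshot J V u t = calc (\<lambda>x. 1 / (1 + t\<^sup>2 * x)) u"
    and "snapshot J V u t \<in> V"
    and "w \<in> V \<Longrightarrow> ip (snapshot J V u t) w + t\<^sup>2 * (snapshot J V u t \<bullet> w) = ip u w"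
proof -
  define z where "z = calc (\<lambda>x. 1 / (1 + t\<^sup>2 * x)) u"
  have zV: "z \<in> V" unfolding z_def by (rule calc_mem)
  have zeq: "ip z w + t\<^sup>2 * (z \<bullet> w) = ip u w" if w: "w \<in> V" for w
  proof -
    have "ip z w + t\<^sup>2 * (z \<bullet> w) = (\<Sum>k=1..n. (1 + t\<^sup>2 * (lam k)\<^sup>2) * ip z (\<phi> k) * ip w (\<phi> k))"
      unfolding parseval[OF zV, of w] inner_eq[OF zV w] sum_distrib_left sum.distrib[symmetric]
      by (intro sum.cong refl) (simp add: algebra_simps)
    also have "\<dots> = (\<Sum>k=1..n. ip u (\<phi> k) * ip w (\<phi> k))"
    proof (intro sum.cong refl)
      fix k assume k: "k \<in> {1..n}"
      have "0 < 1 + t\<^sup>2 * (lam k)\<^sup>2" by (intro add_pos_nonneg) auto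
      thus "(1 + t\<^sup>2 * (lam k)\<^sup>2) * ip z (\<phi> k) * ip w (\<phi> k) = ip u (\<phi> k) * ip w (\<phi> k)"
        by (simp add: z_def ip_calc[OF k])
    qed
    also have "\<dots> = ip u w" using parseval[OF w, of u] by (simp add: mult.commute ip_commute)
    finally show ?thesis .
  qed
  have "snapshot J V u t = z" unfolding snapshot_def
  proof (rule the_equality)
    show "v = z" if "v \<in> V \<and> (\<forall>w\<in>V. ip v w + t\<^sup>2 * (v \<bullet> w) = ip u w)" for v
      unfolding z_def using that by (intro galerkin_solution) auto
  qed (use zV zeq in auto)
  thus "snapshot J V u t = calc (\<lambda>x. 1 / (1 + t\<^sup>2 * x)) u" "snapshot J V u t \<in> V"
    "w \<in> V \<Longrightarrow> ip (snapshot J V u t) w + t\<^sup>2 * (snapshot J V u t \<bullet> w) = ip u w"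
    using zV zeq by (simp_all add: z_def[symmetric])
qed

lemma calc_const_1: "v \<in> V \<Longrightarrow> calc (\<lambda>x. 1) v = v"
  using expansion[of v] by (simp add: spectral_op_def)

lemma calc_diff: "calc (\<lambda>x. g x - h x) v = calc g v - calc h v"
  by (simp add: spectral_op_def sum_subtractf[symmetric] algebra_simps)

lemma calc_scale: "calc (\<lambda>x. c * g x) v = c *\<^sub>R calc g v"
  by (simp add: spectral_op_def scaleR_sum_right mult.assoc)

lemma calc_sum: "calc (\<lambda>x. \<Sum>i\<in>A. g i x) v = (\<Sum>i\<in>A. calc (g i) v)"
proof -
  have "calc (\<lambda>x. \<Sum>i\<in>A. g i x) v = (\<Sum>k=1..n. \<Sum>i\<in>A. (g i ((lam k)\<^sup>2) * ip v (\<phi> k)) *\<^sub>R \<phi> k)"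
    by (simp add: spectral_op_def sum_distrib_right scaleR_sum_left)
  also have "\<dots> = (\<Sum>i\<in>A. calc (g i) v)" unfolding spectral_op_def by (rule sum.swap)
  finally show ?thesis .
qed

lemma rb_op_eq: "rb_op J V \<phi> lam s w = calc (\<lambda>x. x powr s) w"
proof -
  define z where "z = calc (\<lambda>x. x powr s) w"
  have zV: "z \<in> V" unfolding z_def by (rule calc_mem)
  have pw: "((lam k)\<^sup>2) powr s = lam k powr (2 * s)" if "k \<in> {1..n}" for k
    using lam_pos[OF that] by (simp add: powr_powr flip: powr_numeral)
  have zeq: "ip v z = rb_ip J V \<phi> lam s v w" if v: "v \<in> V" for v
    unfolding parseval[OF v, of z] rb_ip_def
    by (intro sum.cong refl) (simp add: z_def ip_calc pw mult_ac)
  show ?thesis unfolding rb_op_def z_def[symmetric]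
  proof (rule the_equality)
    fix y assume y: "y \<in> V \<and> (\<forall>v\<in>V. ip v y = rb_ip J V \<phi> lam s v w)"
    show "y = z"
    proof (rule eqI)
      fix k assume k: "k \<in> {1..n}"
      have "ip (\<phi> k) y = ip (\<phi> k) z" using y zeq[OF eigen_mem[OF k]] eigen_mem[OF k] by simp
      thus "ip y (\<phi> k) = ip z (\<phi> k)" by (simp only: ip_commute[of "\<phi> k"])
    qed (use y zV in auto)
  qed (use zV zeq in auto)
qed

lemma frac_op_eq: "frac_op J n \<phi> lam s v = calc (\<lambda>x. x powr s) v"
  unfolding frac_op_def spectral_op_def
proof (intro sum.cong refl)
  fix k assume k: "k \<in> {1..n}"
  have "((lam k)\<^sup>2) powr s = lam k powr (2 * s)"
    using lam_pos[OF k] by (simp add: powr_powr flip: powr_numeral)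
  thus "(lam k powr (2 * s) * ip v (\<phi> k)) *\<^sub>R \<phi> k = ((lam k)\<^sup>2 powr s * ip v (\<phi> k)) *\<^sub>R \<phi> k" by simp
qed

end

section \<open>Error of the reduced fractional power\<close>
lemma (in discrete_eigensystem) rayleigh_bounds:
  assumes v: "v \<in> V" "ip v v = 1" and ab: "\<And>k. k \<in> {1..n} \<Longrightarrow> a \<le> (lam k)\<^sup>2 \<and> (lam k)\<^sup>2 \<le> b"
  shows "a \<le> v \<bullet> v" "v \<bullet> v \<le> b"
proof -
  have 1: "(\<Sum>k=1..n. (ip v (\<phi> k))\<^sup>2) = 1"
    using parseval[OF v(1), of v] v(2) by (simp add: power2_eq_square)
  have eq: "v \<bullet> v = (\<Sum>k=1..n. (lam k)\<^sup>2 * (ip v (\<phi> k))\<^sup>2)"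
    unfolding inner_eq[OF v(1) v(1)] by (simp add: power2_eq_square mult.assoc)
  have "a * 1 \<le> v \<bullet> v" "v \<bullet> v \<le> b * 1"
    unfolding eq 1[symmetric] sum_distrib_left using ab by (intro sum_mono mult_right_mono; simp)+
  thus "a \<le> v \<bullet> v" "v \<bullet> v \<le> b" by auto
qed

lemma (in discrete_eigensystem) norm0_le_norm2:
  assumes v: "v \<in> V" and a: "0 \<le> a" "\<And>k. k \<in> {1..n} \<Longrightarrow> a \<le> (lam k)\<^sup>2"
  shows "a * norm0 J v \<le> norm2 J n \<phi> lam v"
proof -
  have "(a * norm0 J v)\<^sup>2 = (\<Sum>k=1..n. a\<^sup>2 * (ip v (\<phi> k))\<^sup>2)"
    by (simp add: power_mult_distrib norm0_power2[OF v] sum_distrib_left)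
  also have "\<dots> \<le> (\<Sum>k=1..n. lam k ^ 4 * (ip v (\<phi> k))\<^sup>2)"
  proof (intro sum_mono mult_right_mono)
    fix k assume "k \<in> {1..n}"
    hence "a\<^sup>2 \<le> ((lam k)\<^sup>2)\<^sup>2" using a by (intro power_mono) auto
    thus "a\<^sup>2 \<le> lam k ^ 4" by simp
  qed simp
  finally show ?thesis unfolding norm2_def by (intro real_le_rsqrt)
qed

lemma (in discrete_eigensystem) norm0_le_norm:
  assumes v: "v \<in> V" and a: "0 \<le> a" "\<And>k. k \<in> {1..n} \<Longrightarrow> a\<^sup>2 \<le> (lam k)\<^sup>2"
  shows "a * norm0 J v \<le> norm v"
proof (rule power2_le_imp_le)
  have "(a * norm0 J v)\<^sup>2 = (\<Sum>k=1..n. a\<^sup>2 * (ip v (\<phi> k))\<^sup>2)"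
    by (simp add: power_mult_distrib norm0_power2[OF v] sum_distrib_left)
  also have "\<dots> \<le> (\<Sum>k=1..n. (lam k)\<^sup>2 * (ip v (\<phi> k))\<^sup>2)"
    using a by (intro sum_mono mult_right_mono) auto
  also have "\<dots> = (norm v)\<^sup>2"
    unfolding power2_norm_eq_inner inner_eq[OF v v] by (simp add: power2_eq_square mult.assoc)
  finally show "(a * norm0 J v)\<^sup>2 \<le> (norm v)\<^sup>2" .
qed simp

locale reduced_eigensystem =
  full: discrete_eigensystem J V \<phi> lam + red: discrete_eigensystem J Vr \<psi> \<mu>
  for J :: "'b::real_inner \<Rightarrow> 'a::real_inner" and V \<phi> lam Vr \<psi> \<mu> +
  assumes subset: "Vr \<subseteq> V"
begin

abbreviation "full_calc \<equiv> spectral_op J (dim V) \<phi> lam"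
abbreviation "red_calc \<equiv> spectral_op J (dim Vr) \<psi> \<mu>"

lemma reduced_spectrum:
  assumes ab: "\<And>k. k \<in> {1..dim V} \<Longrightarrow> a \<le> (lam k)\<^sup>2 \<and> (lam k)\<^sup>2 \<le> b" and j: "j \<in> {1..dim Vr}"
  shows "a \<le> (\<mu> j)\<^sup>2" "(\<mu> j)\<^sup>2 \<le> b"
proof -
  have one: "ip0 J (\<psi> j) (\<psi> j) = 1" using red.orthonormal[OF j j] by simp
  have "\<psi> j \<bullet> \<psi> j = (\<mu> j)\<^sup>2" using red.eigen_eq[OF j red.eigen_mem[OF j]] one by simp
  thus "a \<le> (\<mu> j)\<^sup>2" "(\<mu> j)\<^sup>2 \<le> b"
    using full.rayleigh_bounds[OF _ one ab] red.eigen_mem[OF j] subset by auto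
qed

lemma exact_on_snapshots:
  assumes "snapshot J V u t \<in> Vr"
  shows "red_calc (\<lambda>x. 1 / (1 + t\<^sup>2 * x)) u = full_calc (\<lambda>x. 1 / (1 + t\<^sup>2 * x)) u"
proof -
  have "snapshot J V u t = red_calc (\<lambda>x. 1 / (1 + t\<^sup>2 * x)) u"
    using subset by (intro red.galerkin_solution[OF assms] full.snapshot_spec(3)) auto
  thus ?thesis by (simp only: full.snapshot_spec(1))
qed

text \<open>
  With \<open>W\<close> the product over \<open>T\<close>, \<open>y / (x + y)\<close> equals \<open>q y + W x * W y * y / (x + y)\<close>, where \<open>q\<close> is a
  combination of \<open>1 - 1 / (1 + \<tau> y)\<close>, on which both calculi agree. The factor \<open>b / (x + b)\<close> makes the
  bound integrable against \<open>x\<^sup>s\<^sup>-\<^sup>1\<close>.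
\<close>
lemma resolvent_error:
  assumes u: "u \<in> Vr" and T: "finite T" "\<And>\<tau>. \<tau> \<in> T \<Longrightarrow> 0 < \<tau>"
    and exact: "\<And>\<tau>. \<tau> \<in> T \<Longrightarrow> red_calc (\<lambda>x. 1 / (1 + \<tau> * x)) u = full_calc (\<lambda>x. 1 / (1 + \<tau> * x)) u"
    and ab: "0 < a" "\<And>k. k \<in> {1..dim V} \<Longrightarrow> a \<le> (lam k)\<^sup>2 \<and> (lam k)\<^sup>2 \<le> b" and b: "0 < b"
    and E: "0 \<le> E" "\<And>y. a \<le> y \<Longrightarrow> y \<le> b \<Longrightarrow> \<bar>\<Prod>\<tau>\<in>T. blaschke \<tau> y\<bar> \<le> E"
    and x: "0 < x"
  shows "norm0 J (red_calc (\<lambda>y. y / (x + y)) u - full_calc (\<lambda>y. y / (x + y)) u)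
    \<le> 2 * E * norm0 J u * (b / (x + b))"
proof -
  define W where "W y = (\<Prod>\<tau>\<in>T. blaschke \<tau> y)" for y
  obtain c where c: "\<And>y. 0 < y \<Longrightarrow> (1 - W y * W x) / (x + y) = (\<Sum>\<tau>\<in>T. c \<tau> / (1 + \<tau> * y))"
    using partial_fractions[OF T(1) _ x] T(2) unfolding W_def by blast
  \<comment> \<open>\<open>y\<close> times the interpolant of \<open>1 / (x + y)\<close>; the constant \<open>1\<close> enters as
      \<open>y / (1 + \<tau> y) = (1 - 1 / (1 + \<tau> y)) / \<tau>\<close>\<close>
  define q where "q y = (\<Sum>\<tau>\<in>T. c \<tau> / \<tau> * (1 - 1 / (1 + \<tau> * y)))" for y
  define e where "e y = y / (x + y) - q y" for y
  have uV: "u \<in> V" using u subset by auto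
  have one: "red_calc (\<lambda>y. 1) u = full_calc (\<lambda>y. 1) u"
    by (simp only: red.calc_const_1[OF u] full.calc_const_1[OF uV])
  have q: "red_calc q u = full_calc q u"
    unfolding q_def[abs_def] red.calc_sum full.calc_sum red.calc_scale full.calc_scale
      red.calc_diff full.calc_diff one
    by (intro sum.cong refl) (simp only: exact)
  have e: "e y = W x * W y * (y / (x + y))" if y: "0 < y" for y
  proof -
    have "q y = y * (\<Sum>\<tau>\<in>T. c \<tau> / (1 + \<tau> * y))"
      unfolding q_def sum_distrib_left
    proof (intro sum.cong refl)
      fix \<tau> assume "\<tau> \<in> T"
      hence t: "0 < \<tau>" "0 < 1 + \<tau> * y" using T(2) y by (auto intro!: add_pos_pos)
      hence "1 - 1 / (1 + \<tau> * y) = \<tau> * y / (1 + \<tau> * y)" by (simp add: field_simps)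
      thus "c \<tau> / \<tau> * (1 - 1 / (1 + \<tau> * y)) = y * (c \<tau> / (1 + \<tau> * y))" using t by simp
    qed
    also have "\<dots> = y * ((1 - W y * W x) / (x + y))" using c[OF y] by simp
    finally show ?thesis unfolding e_def by (simp add: right_diff_distrib diff_divide_distrib mult_ac)
  qed
  have Wx: "\<bar>W x\<bar> \<le> 1"
    unfolding W_def abs_prod using T(2) x by (intro prod_le_1) (auto intro: abs_blaschke_le_1)
  have ebound: "\<bar>e y\<bar> \<le> E * (b / (x + b))" if y: "a \<le> y" "y \<le> b" for y
  proof -
    have y0: "0 < y" using y ab(1) by linarith
    have "y / (x + y) \<le> b / (x + b)" using y0 y x b by (simp add: divide_simps) (simp add: algebra_simps)
    hence "\<bar>W x\<bar> * \<bar>W y\<bar> * \<bar>y / (x + y)\<bar> \<le> 1 * E * (b / (x + b))"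
      using Wx E(2)[OF y] E(1) y0 x b by (intro mult_mono) (auto simp: W_def)
    thus ?thesis unfolding e[OF y0] by (simp add: abs_mult)
  qed
  have M: "0 \<le> E * (b / (x + b))" using E(1) x b by simp
  have "red_calc (\<lambda>y. y / (x + y)) u - full_calc (\<lambda>y. y / (x + y)) u = red_calc e u - full_calc e u"
    unfolding e_def[abs_def] red.calc_diff full.calc_diff q by simp
  hence "norm0 J (red_calc (\<lambda>y. y / (x + y)) u - full_calc (\<lambda>y. y / (x + y)) u)
      \<le> norm0 J (red_calc e u) + norm0 J (full_calc e u)"
    by (simp add: norm0_def linear_diff[OF full.linear_J] norm_triangle_ineq4)
  also have "norm0 J (red_calc e u) \<le> E * (b / (x + b)) * norm0 J u"
    using reduced_spectrum[OF ab(2)] by (intro red.norm0_calc_le[OF u] ebound M) auto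
  also have "norm0 J (full_calc e u) \<le> E * (b / (x + b)) * norm0 J u"
    using ab(2) by (intro full.norm0_calc_le[OF uV] ebound M) auto
  finally show ?thesis by (simp add: algebra_simps)
qed

text \<open>
  Both calculi are tested against the error \<open>z\<close> itself. This makes the scalar statement
  \<open>powr_combination_bound\<close> applicable to the weights of the two eigensystems taken together, and its
  conclusion is a bound of \<open>\<parallel>z\<parallel>\<^sup>2\<close> by a multiple of \<open>\<parallel>z\<parallel>\<close>.
\<close>
lemma powr_error:
  assumes s: "0 < s" "s < 1"
    and u: "u \<in> Vr" and T: "finite T" "\<And>\<tau>. \<tau> \<in> T \<Longrightarrow> 0 < \<tau>"
    and exact: "\<And>\<tau>. \<tau> \<in> T \<Longrightarrow> red_calc (\<lambda>x. 1 / (1 + \<tau> * x)) u = full_calc (\<lambda>x. 1 / (1 + \<tau> * x)) u"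
    and ab: "0 < a" "\<And>k. k \<in> {1..dim V} \<Longrightarrow> a \<le> (lam k)\<^sup>2 \<and> (lam k)\<^sup>2 \<le> b" and b: "0 < b"
    and E: "0 \<le> E" "\<And>y. a \<le> y \<Longrightarrow> y \<le> b \<Longrightarrow> \<bar>\<Prod>\<tau>\<in>T. blaschke \<tau> y\<bar> \<le> E"
  shows "norm0 J (red_calc (\<lambda>y. y powr s) u - full_calc (\<lambda>y. y powr s) u)
    \<le> 2 * E * norm0 J u * b powr s"
proof -
  define z where "z = red_calc (\<lambda>y. y powr s) u - full_calc (\<lambda>y. y powr s) u"
  define A where "A = {1..dim Vr} <+> {1..dim V}"
  define w where "w = case_sum (\<lambda>j. ip0 J u (\<psi> j) * ip0 J (\<psi> j) z) (\<lambda>k. - (ip0 J u (\<phi> k) * ip0 J (\<phi> k) z))"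
  define p where "p = case_sum (\<lambda>j. (\<mu> j)\<^sup>2) (\<lambda>k. (lam k)\<^sup>2)"
  have test: "(\<Sum>i\<in>A. w i * g (p i)) = ip0 J (red_calc g u - full_calc g u) z" for g
  proof -
    have "(\<Sum>i\<in>A. w i * g (p i)) = (\<Sum>j=1..dim Vr. ip0 J u (\<psi> j) * ip0 J (\<psi> j) z * g ((\<mu> j)\<^sup>2))
        - (\<Sum>k=1..dim V. ip0 J u (\<phi> k) * ip0 J (\<phi> k) z * g ((lam k)\<^sup>2))"
      unfolding A_def by (subst sum.Plus) (simp_all add: w_def p_def sum_negf)
    also have "(\<Sum>j=1..dim Vr. ip0 J u (\<psi> j) * ip0 J (\<psi> j) z * g ((\<mu> j)\<^sup>2)) = ip0 J (red_calc g u) z"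
      unfolding spectral_op_def full.ip_sum full.ip_scale by (intro sum.cong refl) (simp only: mult_ac)
    also have "(\<Sum>k=1..dim V. ip0 J u (\<phi> k) * ip0 J (\<phi> k) z * g ((lam k)\<^sup>2)) = ip0 J (full_calc g u) z"
      unfolding spectral_op_def full.ip_sum full.ip_scale by (intro sum.cong refl) (simp only: mult_ac)
    finally show ?thesis by (simp only: full.ip_diff)
  qed
  have "\<bar>\<Sum>i\<in>A. w i * p i powr s\<bar> \<le> (2 * E * norm0 J u * norm0 J z) * b powr s"
  proof (rule powr_combination_bound[OF s _ b])
    fix i assume "i \<in> A"
    thus "0 < p i" using red.lam_pos full.lam_pos by (fastforce simp: A_def p_def)
  next
    fix x :: real assume x: "0 < x"
    have "\<bar>\<Sum>i\<in>A. w i * (p i / (x + p i))\<bar>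
        \<le> norm0 J (red_calc (\<lambda>y. y / (x + y)) u - full_calc (\<lambda>y. y / (x + y)) u) * norm0 J z"
      unfolding test[of "\<lambda>y. y / (x + y)"] ip0_def norm0_def by (rule Cauchy_Schwarz_ineq2)
    also have "\<dots> \<le> 2 * E * norm0 J u * (b / (x + b)) * norm0 J z"
      by (intro mult_right_mono resolvent_error[OF u T exact ab b E x]) (simp_all add: norm0_def)
    finally show "\<bar>\<Sum>i\<in>A. w i * (p i / (x + p i))\<bar> \<le> (2 * E * norm0 J u * norm0 J z) * (b / (x + b))"
      by (simp add: mult_ac)
  qed
  also have "(\<Sum>i\<in>A. w i * p i powr s) = (norm0 J z)\<^sup>2"
    unfolding test[of "\<lambda>y. y powr s"] z_def[symmetric] by (simp add: ip0_def norm0_def power2_norm_eq_inner)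
  finally have "norm0 J z * norm0 J z \<le> (2 * E * norm0 J u * b powr s) * norm0 J z"
    by (simp add: power2_eq_square mult_ac)
  moreover have "0 \<le> norm0 J z" "0 \<le> 2 * E * norm0 J u * b powr s"
    using E(1) by (simp_all add: norm0_def)
  ultimately have "norm0 J z \<le> 2 * E * norm0 J u * b powr s"
    by (cases "norm0 J z = 0") (auto simp: mult_le_cancel_right)
  thus ?thesis by (simp add: z_def)
qed

end

text \<open>
  The map \<open>y \<mapsto> lamL\<^sup>2 / y\<close> takes the spectral interval to \<open>[\<delta>, 1]\<close> and the Blaschke factors for
  \<open>t\<^sub>j\<^sup>2 = Z\<^sub>j / lamL\<^sup>2\<close> to the factors \<open>(x - Z\<^sub>j) / (x + Z\<^sub>j)\<close> of the Zolotarev product, up to sign.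
\<close>
lemma zolotarev_space_error:
  fixes J :: "'b::real_inner \<Rightarrow> 'a::real_inner"
  assumes J: "linear J" "inj J" and s: "0 < s" "s < 1"
    and lamLU: "0 < lamL" "lamL < lamU"
    and V: "subspace V" "\<exists>B. finite B \<and> span B = V"
    and eig: "eigenpairs_on J V \<phi> lam" and mono: "\<And>k. k \<in> {1..<dim V} \<Longrightarrow> (lam k)\<^sup>2 \<le> (lam (Suc k))\<^sup>2"
    and u: "u \<in> V" and zolo: "zolotarev_space J V lam u lamL lamU r Vr"
    and reig: "eigenpairs_on J Vr \<psi> \<mu>"
  defines "err \<equiv> norm0 J (rb_op J Vr \<psi> \<mu> s u - frac_op J (dim V) \<phi> lam s u)"
    and "M \<equiv> 8 * (lamU\<^sup>2) powr s * exp (- C_star (lamL\<^sup>2 / lamU\<^sup>2) * r)"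
  shows "lamL\<^sup>2 * err \<le> M * norm2 J (dim V) \<phi> lam u" "lamL * err \<le> M * norm u"
proof -
  define \<delta> where "\<delta> = lamL\<^sup>2 / lamU\<^sup>2"
  have LU: "0 < lamL\<^sup>2" "lamL\<^sup>2 < lamU\<^sup>2" "0 < lamU\<^sup>2"
    using lamLU by (auto intro!: power_strict_mono)
  have \<delta>: "0 < \<delta>" "\<delta> < 1" using LU by (simp_all add: \<delta>_def)
  interpret full: discrete_eigensystem J V \<phi> lam
    by (rule discrete_eigensystem.intro[OF J V eig])
  have bounds: "lamL\<^sup>2 \<le> (lam k)\<^sup>2 \<and> (lam k)\<^sup>2 \<le> lamU\<^sup>2" if k: "k \<in> {1..dim V}" for k
  proof -
    have up: "(lam i)\<^sup>2 \<le> (lam j)\<^sup>2" if "i \<le> j" "1 \<le> i" "j \<le> dim V" for i j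
      using that
    proof (induction j rule: dec_induct)
      case (step j)
      have "(lam j)\<^sup>2 \<le> (lam (Suc j))\<^sup>2" using step by (intro mono) auto
      thus ?case using step by auto
    qed simp
    show ?thesis using up[of 1 k] up[of k "dim V"] k zolo by (auto simp: zolotarev_space_def)
  qed
  obtain t where t: "t 0 = 0" "\<And>i. i < r \<Longrightarrow> t i < t (Suc i)"
      "\<And>j. j \<in> {1..r} \<Longrightarrow> (t j)\<^sup>2 = transformed_zolotarev_point (1 / lamU\<^sup>2) (1 / lamL\<^sup>2) r j"
      "Vr = reduced_space J V u t r"
    using zolo unfolding zolotarev_space_def by blast
  have tless: "t i < t j" if "i < j" "j \<le> r" for i j
    using that
  proof (induction j)
    case (Suc j)
    thus ?case using t(2)[of j] by (cases "i = j") auto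
  qed simp
  have tpos: "0 < t j" if "j \<in> {1..r}" for j using tless[of 0 j] that t(1) by simp
  have snap: "snapshot J V u (t j) \<in> Vr" if "j \<le> r" for j
    unfolding t(4) reduced_space_def using that by (intro span_base) auto
  have "snapshot J V u (t 0) = u"
    using full.snapshot_spec(1)[of u "t 0"] full.calc_const_1[OF u] by (simp add: t(1))
  hence uVr: "u \<in> Vr" using snap[of 0] by simp
  have sub: "Vr \<subseteq> V"
    unfolding t(4) reduced_space_def using full.snapshot_spec(2) V(1) by (intro span_minimal) auto
  interpret reduced_eigensystem J V \<phi> lam Vr \<psi> \<mu>
  proof (rule reduced_eigensystem.intro)
    show "discrete_eigensystem J V \<phi> lam" by (rule full.discrete_eigensystem_axioms)
    have "subspace Vr" unfolding t(4) reduced_space_def by (rule subspace_span)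
    moreover have "\<exists>B. finite B \<and> span B = Vr" unfolding t(4) reduced_space_def by blast
    ultimately show "discrete_eigensystem J Vr \<psi> \<mu>"
      using reig by (rule discrete_eigensystem.intro[OF J])
    show "reduced_eigensystem_axioms V Vr" by (rule reduced_eigensystem_axioms.intro[OF sub])
  qed
  define T where "T = (\<lambda>j. (t j)\<^sup>2) ` {1..r}"
  have inj: "inj_on (\<lambda>j. (t j)\<^sup>2) {1..r}"
  proof (rule inj_onI)
    fix i j assume ij: "i \<in> {1..r}" "j \<in> {1..r}" "(t i)\<^sup>2 = (t j)\<^sup>2"
    hence "t i = t j" using tpos[of i] tpos[of j] by (simp add: power2_eq_iff)
    thus "i = j" using tless[of i j] tless[of j i] ij by (cases i j rule: linorder_cases) auto
  qed
  have T: "finite T" "\<And>\<tau>. \<tau> \<in> T \<Longrightarrow> 0 < \<tau>"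
  proof -
    show "finite T" by (simp add: T_def)
    fix \<tau> assume "\<tau> \<in> T"
    then obtain j where "j \<in> {1..r}" "\<tau> = (t j)\<^sup>2" by (auto simp: T_def)
    thus "0 < \<tau>" using tpos[of j] by simp
  qed
  have exact: "red_calc (\<lambda>x. 1 / (1 + \<tau> * x)) u = full_calc (\<lambda>x. 1 / (1 + \<tau> * x)) u" if "\<tau> \<in> T" for \<tau>
  proof -
    obtain j where "j \<le> r" "\<tau> = (t j)\<^sup>2" using \<open>\<tau> \<in> T\<close> by (auto simp: T_def)
    thus ?thesis using exact_on_snapshots[OF snap[of j]] by simp
  qed
  have small: "\<bar>\<Prod>\<tau>\<in>T. blaschke \<tau> y\<bar> \<le> 4 * exp (- C_star \<delta> * r)" if y: "lamL\<^sup>2 \<le> y" "y \<le> lamU\<^sup>2" for y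
  proof -
    define x where "x = lamL\<^sup>2 / y"
    have y0: "0 < y" using y LU by linarith
    have x: "\<delta> \<le> x" "x \<le> 1"
    proof -
      show "\<delta> \<le> x" unfolding x_def \<delta>_def
        by (rule divide_left_mono[OF y(2) _ mult_pos_pos[OF LU(3) y0]]) (use LU in simp)
      show "x \<le> 1" unfolding x_def using y(1) y0 by simp
    qed
    have x0: "0 < x" using \<delta> x by linarith
    have factor: "\<bar>blaschke ((t j)\<^sup>2) y\<bar> = \<bar>(x - zolotarev_point \<delta> r j) / (x + zolotarev_point \<delta> r j)\<bar>"
      if j: "j \<in> {1..r}" for j
    proof -
      define Z where "Z = zolotarev_point \<delta> r j"
      have Z: "0 < Z" unfolding Z_def by (rule zolotarev_point_pos[OF \<delta>])
      have "(t j)\<^sup>2 = Z / lamL\<^sup>2"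
        using t(3)[OF j] by (simp add: transformed_zolotarev_point_def Z_def \<delta>_def)
      hence tj: "(t j)\<^sup>2 * y = Z / x" by (simp add: x_def)
      have "blaschke ((t j)\<^sup>2) y = (Z / x - 1) / (Z / x + 1)" by (simp add: blaschke_def tj)
      also have "\<dots> = ((Z - x) / x) / ((Z + x) / x)" using x0 by (simp add: diff_divide_distrib add_divide_distrib)
      also have "\<dots> = (Z - x) / (Z + x)" using x0 by simp
      finally show ?thesis by (simp add: Z_def abs_divide abs_minus_commute add.commute)
    qed
    have "\<bar>\<Prod>\<tau>\<in>T. blaschke \<tau> y\<bar> = (\<Prod>j=1..r. \<bar>blaschke ((t j)\<^sup>2) y\<bar>)"
      unfolding T_def abs_prod prod.reindex[OF inj] o_def by (rule refl)
    also have "\<dots> = \<bar>\<Prod>j=1..r. (x - zolotarev_point \<delta> r j) / (x + zolotarev_point \<delta> r j)\<bar>"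
      unfolding abs_prod by (intro prod.cong refl factor)
    also have "\<dots> \<le> 4 * exp (- C_star \<delta> * r)" by (rule zolotarev_product_le[OF \<delta> x])
    finally show ?thesis .
  qed
  have "err = norm0 J (red_calc (\<lambda>y. y powr s) u - full_calc (\<lambda>y. y powr s) u)"
    unfolding err_def red.rb_op_eq full.frac_op_eq ..
  also have "\<dots> \<le> 2 * (4 * exp (- C_star \<delta> * r)) * norm0 J u * (lamU\<^sup>2) powr s"
    by (rule powr_error[OF s uVr T exact LU(1) bounds LU(3) _ small]) simp_all
  also have "\<dots> = M * norm0 J u" by (simp add: M_def \<delta>_def)
  finally have err: "err \<le> M * norm0 J u" .
  have M: "0 \<le> M" by (simp add: M_def)
  have "lamL\<^sup>2 * err \<le> lamL\<^sup>2 * (M * norm0 J u)" using err by (intro mult_left_mono) auto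
  also have "\<dots> = M * (lamL\<^sup>2 * norm0 J u)" by simp
  also have "\<dots> \<le> M * norm2 J (dim V) \<phi> lam u"
    using bounds by (intro mult_left_mono M full.norm0_le_norm2 u) auto
  finally show "lamL\<^sup>2 * err \<le> M * norm2 J (dim V) \<phi> lam u" .
  have "lamL * err \<le> lamL * (M * norm0 J u)" using err lamLU by (intro mult_left_mono) auto
  also have "\<dots> = M * (lamL * norm0 J u)" by simp
  also have "\<dots> \<le> M * norm u"
    using bounds lamLU by (intro mult_left_mono M full.norm0_le_norm u) auto
  finally show "lamL * err \<le> M * norm u" .
qed

theorem theorem5p19:
  fixes J :: "'b::{real_inner, complete_space} \<Rightarrow> 'a::{real_inner, complete_space}"
    and s lamL lamU \<delta> :: real
  assumes "linear J" and "inj J" and "closure (range J) = UNIV"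
    and "compact (closure (J ` cball 0 1))"
    and "0 < s" and "s < 1"
    and "0 < lamL" and "lamL < lamU"
    and "\<delta> = lamL\<^sup>2 / lamU\<^sup>2"
  shows "\<exists>C :: real \<Rightarrow> real.
    (\<forall>d\<in>{0<..<1}. 0 < C d \<and> C d = C_star d) \<and>
    C \<in> O[at_right 0](\<lambda>d. 1 / ln (1 / d)) \<and>
    (\<exists>c>0. \<forall>(Vh :: 'b set) N \<phi> lam u r Vr \<psi> \<mu>.
      subspace Vh \<longrightarrow> (\<exists>B. finite B \<and> span B = Vh) \<longrightarrow> dim Vh = N \<longrightarrow>
      eigenpairs_on J Vh \<phi> lam \<longrightarrow> (\<forall>k\<in>{1..<N}. (lam k)\<^sup>2 \<le> (lam (Suc k))\<^sup>2) \<longrightarrow>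
      u \<in> Vh \<longrightarrow> zolotarev_space J Vh lam u lamL lamU r Vr \<longrightarrow>
      r + 1 \<le> num_active_eigenvalues J N \<phi> lam u \<longrightarrow>
      eigenpairs_on J Vr \<psi> \<mu> \<longrightarrow>
      norm0 J (rb_op J Vr \<psi> \<mu> s u - frac_op J N \<phi> lam s u)
        \<le> c * exp (- C \<delta> * real r) * norm2 J N \<phi> lam u \<and>
      (s < 1 / 2 \<longrightarrow>
        norm0 J (rb_op J Vr \<psi> \<mu> s u - frac_op J N \<phi> lam s u)
          \<le> c * exp (- C \<delta> * real r) * norm u))"
proof -
  define c where "c = 8 * (lamU\<^sup>2) powr s * (1 / lamL\<^sup>2 + 1 / lamL)"
  define K where "K = 8 * (lamU\<^sup>2) powr s"
  have K: "0 < K" using assms by (simp add: K_def)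
  have inv: "0 < 1 / lamL\<^sup>2" "0 < 1 / lamL" using assms by simp_all
  have c: "0 < c" "K * (1 / lamL\<^sup>2) \<le> c" "K * (1 / lamL) \<le> c"
  proof -
    show "0 < c" unfolding c_def K_def[symmetric] using K inv by (intro mult_pos_pos add_pos_pos)
    show "K * (1 / lamL\<^sup>2) \<le> c" "K * (1 / lamL) \<le> c"
      unfolding c_def K_def[symmetric] using K inv by (intro mult_left_mono; linarith)+
  qed
  have main: "err \<le> c * e * q"
    if le: "p * err \<le> K * e * q" and p: "0 < p" "K * (1 / p) \<le> c" and e: "0 \<le> e" "0 \<le> q"
    for err e q p :: real
  proof -
    have "err \<le> K * (1 / p) * (e * q)" using le p(1) by (simp add: field_simps)
    also have "\<dots> \<le> c * (e * q)" using p e by (intro mult_right_mono) auto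
    finally show ?thesis by (simp add: mult.assoc)
  qed
  show ?thesis
  proof (intro exI[of _ C_star] conjI ballI C_star_bigo)
    fix d :: real assume "d \<in> {0<..<1}"
    thus "0 < C_star d" using C_star_pos by simp
  next
    show "\<exists>c>0. \<forall>(Vh :: 'b set) N \<phi> lam u r Vr \<psi> \<mu>.
      subspace Vh \<longrightarrow> (\<exists>B. finite B \<and> span B = Vh) \<longrightarrow> dim Vh = N \<longrightarrow>
      eigenpairs_on J Vh \<phi> lam \<longrightarrow> (\<forall>k\<in>{1..<N}. (lam k)\<^sup>2 \<le> (lam (Suc k))\<^sup>2) \<longrightarrow>
      u \<in> Vh \<longrightarrow> zolotarev_space J Vh lam u lamL lamU r Vr \<longrightarrow>
      r + 1 \<le> num_active_eigenvalues J N \<phi> lam u \<longrightarrow>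
      eigenpairs_on J Vr \<psi> \<mu> \<longrightarrow>
      norm0 J (rb_op J Vr \<psi> \<mu> s u - frac_op J N \<phi> lam s u)
        \<le> c * exp (- C_star \<delta> * real r) * norm2 J N \<phi> lam u \<and>
      (s < 1 / 2 \<longrightarrow>
        norm0 J (rb_op J Vr \<psi> \<mu> s u - frac_op J N \<phi> lam s u)
          \<le> c * exp (- C_star \<delta> * real r) * norm u)"
    proof (intro exI[of _ c] conjI allI impI c(1))
      fix Vh :: "'b set" and N \<phi> lam u r Vr \<psi> \<mu>
      assume V: "subspace Vh" "\<exists>B. finite B \<and> span B = Vh" and N: "dim Vh = N"
        and eig: "eigenpairs_on J Vh \<phi> lam" and mono: "\<forall>k\<in>{1..<N}. (lam k)\<^sup>2 \<le> (lam (Suc k))\<^sup>2"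
        and u: "u \<in> Vh" and zolo: "zolotarev_space J Vh lam u lamL lamU r Vr"
        and reig: "eigenpairs_on J Vr \<psi> \<mu>"
      have mono': "(lam k)\<^sup>2 \<le> (lam (Suc k))\<^sup>2" if "k \<in> {1..<dim Vh}" for k
        using mono that N by blast
      note err = zolotarev_space_error[OF assms(1,2,5-8) V eig mono' u zolo reig,
          folded assms(9) K_def, unfolded N]
      have n2: "0 \<le> norm2 J N \<phi> lam u" unfolding norm2_def by (intro real_sqrt_ge_zero sum_nonneg) simp
      show "norm0 J (rb_op J Vr \<psi> \<mu> s u - frac_op J N \<phi> lam s u)
          \<le> c * exp (- C_star \<delta> * real r) * norm2 J N \<phi> lam u"
        by (rule main[OF err(1)]) (use assms c n2 in auto)
      show "norm0 J (rb_op J Vr \<psi> \<mu> s u - frac_op J N \<phi> lam s u)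
          \<le> c * exp (- C_star \<delta> * real r) * norm u"
        by (rule main[OF err(2)]) (use assms c in auto)
    qed
  qed simp
qed

end
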